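(* Let $M_t$ be a family of smooth closed strictly convex surfaces in $\mathbb{R}^3$ moving according to $\frac{d}{dt}X=\frac1K\nu$. Then $$\max_{M_t}\frac{(\lambda_1-\lambda_2)^2}{4\lambda_1^2\lambda_2^2}=\max_{M_t}\frac{2|A|^2-H^2}{(H^2-|A|^2)^2}$$ is non-increasing in time.
   Context: $X$ denotes the embedding, $\nu$ the outer unit normal, $\lambda_1,\lambda_2>0$ the principal curvatures, $K=\lambda_1\lambda_2$ the Gauss curvature, $H=\lambda_1+\lambda_2$ the mean curvature and $|A|^2=\lambda_1^2+\lambda_2^2$ the squared norm of the second fundamental form. *)

theory Defs
  imports "HOL-Analysis.Analysis"
begin

definition dirder :: "'a::real_normed_vector \<Rightarrow> ('a \<Rightarrow> 'b::real_normed_vector) \<Rightarrow> 'a \<Rightarrow> 'b" where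
  "dirder v f = (\<lambda>x. frechet_derivative f (at x) v)"

definition smooth_on :: "'a::euclidean_space set \<Rightarrow> ('a \<Rightarrow> 'b::real_normed_vector) \<Rightarrow> bool" where
  "smooth_on U f \<longleftrightarrow> open U \<and> (\<forall>vs. (foldr dirder vs f) differentiable_on U)"

abbreviation S2 :: "(real^3) set" where "S2 \<equiv> sphere 0 1"

definition tangent :: "real^3 \<Rightarrow> (real^3) set" where
  "tangent u = {v. v \<bullet> u = 0}"

definition dX :: "(real^3 \<Rightarrow> real \<Rightarrow> real^3) \<Rightarrow> real^3 \<Rightarrow> real \<Rightarrow> real^3 \<Rightarrow> real^3" where
  "dX X u t v = frechet_derivative (\<lambda>x. X x t) (at u) v"

(* Principal curvatures at X(u,t) w.r.t. the normal field N: eigenvalues of the Weingarten map,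
   i.e. lam with dN(v) = lam * dX(v) for some nonzero tangent v. *)
definition princ_curvs :: "(real^3 \<Rightarrow> real \<Rightarrow> real^3) \<Rightarrow> (real^3 \<Rightarrow> real \<Rightarrow> real^3) \<Rightarrow> real^3 \<Rightarrow> real \<Rightarrow> real set" where
  "princ_curvs X N u t = {lam. \<exists>v\<in>tangent u. v \<noteq> 0 \<and> dX N u t v = lam *\<^sub>R dX X u t v}"

definition lam1 where "lam1 X N u t = Max (princ_curvs X N u t)"
definition lam2 where "lam2 X N u t = Min (princ_curvs X N u t)"

definition gaussK where "gaussK X N u t = lam1 X N u t * lam2 X N u t"
definition meanH where "meanH X N u t = lam1 X N u t + lam2 X N u t"
definition normA2 where "normA2 X N u t = (lam1 X N u t)\<^sup>2 + (lam2 X N u t)\<^sup>2"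

(* M_t = X(S^2,t) is a smooth closed strictly convex (embedded) surface with outer unit normal N(.,t). *)
definition closed_strictly_convex_surface ::
  "(real^3 \<Rightarrow> real \<Rightarrow> real^3) \<Rightarrow> (real^3 \<Rightarrow> real \<Rightarrow> real^3) \<Rightarrow> real \<Rightarrow> bool" where
  "closed_strictly_convex_surface X N t \<longleftrightarrow>
     inj_on (\<lambda>x. X x t) S2 \<and>
     (\<forall>u\<in>S2. \<forall>v\<in>tangent u. v \<noteq> 0 \<longrightarrow> dX X u t v \<noteq> 0) \<and>
     (\<forall>u\<in>S2. norm (N u t) = 1 \<and> (\<forall>v\<in>tangent u. N u t \<bullet> dX X u t v = 0) \<and>
              (\<forall>w\<in>S2. (X w t - X u t) \<bullet> N u t \<le> 0)) \<and>
     (\<forall>u\<in>S2. \<forall>lam\<in>princ_curvs X N u t. lam > 0)"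

end

theory Submission
  imports Defs
begin

text \<open>
  In the Gauss-map parametrisation the support function \<open>h\<close>, extended to be 1-homogeneous on
  $\mathbb{R}^3 - \{0\}$, evolves by $h_t = |z|^3 \sigma_2(D^2 h)$, and the eigenvalues of $D^2 h$
  on the sphere are $1/\lambda_1, 1/\lambda_2, 0$. Hence the quantity of the theorem is
  $G = |z|^2 (|D^2 h|^2/2 - (\Delta h)^2/4)$, which is 0-homogeneous.
  At a spatial maximum of $G$, in an eigenframe with eigenvalues $p, q$ of $D^2 h$, the first-order
  condition gives $h_{111} = h_{122} =: \alpha$ and $h_{112} = h_{222} =: \beta$ (unless $p = q$), and then
  $G_t = q G_{11} + p G_{22} - 2 (p + q) G - 2 (p \beta^2 + q \alpha^2) \le 0$.
  Applied to a maximum of $G - \varepsilon t$ this yields the claim.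
  The Gauss map is never inverted: with $Y(x,t) = |x| N(x/|x|,t)$ one differentiates functions of
  $(x,t)$ along the vector fields dual to $(Y,t)$, which commute like coordinate derivatives.
\<close>

section \<open>Calculus of smooth functions\<close>

text \<open>The quantity equals (1/\<lambda>_1 - 1/\<lambda>_2)^2 / 4, the squared half-difference
  of the principal radii, and these radii are the eigenvalues of D^2 h; this is what the support
  function buys. The homogeneous extension trades the sphere for flat space: covariant derivatives
  become ordinary ones, and the curvature of the sphere survives only in the Euler relation D^2 h(Y,
  .) = 0 and in the powers of |z|. Treating h as a function of the normal would call for a global
  inverse of the Gauss map, smooth jointly in time. The dual fields need only an invertible
  differential, which strict convexity supplies pointwise. The weights q and p of G_11 and G_22 are
  the coefficients of the linearised \<sigma>_2, so all fourth derivatives of h cancel against G_t.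
  The dual time field holds the normal fixed, whereas the maximum argument runs at a fixed parameter
  point; the two derivatives differ by a spatial one, which vanishes at a spatial maximum.\<close>

primrec Ck :: "nat \<Rightarrow> 'a::euclidean_space set \<Rightarrow> ('a \<Rightarrow> 'b::real_normed_vector) \<Rightarrow> bool" where
  "Ck 0 U f = True"
| "Ck (Suc n) U f = (f differentiable_on U \<and> (\<forall>v. Ck n U (dirder v f)))"

text \<open>Grading by order makes induction possible, which the quantifier over all lists in
  \<open>smooth_on\<close> does not. \<open>Ck\<close> peels off the innermost derivative while
  \<open>foldr\<close> adds the outermost, hence the lists \<open>_ @ [v]\<close> in the second
  direction.\<close>

lemma Ck_foldr: "(\<forall>n. Ck n U f) \<longleftrightarrow> (\<forall>vs. (foldr dirder vs f) differentiable_on U)"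
proof
  assume *: "\<forall>n. Ck n U f"
  have "\<forall>n. Ck n U (foldr dirder vs f)" for vs
  proof (induction vs)
    case (Cons v vs)
    have "Ck n U (dirder v (foldr dirder vs f))" for n
      using Cons[rule_format, of "Suc n"] unfolding Ck.simps by blast
    then show ?case by simp
  qed (use * in simp)
  then show "\<forall>vs. (foldr dirder vs f) differentiable_on U"
    by (meson Ck.simps(2))
next
  assume *: "\<forall>vs. (foldr dirder vs f) differentiable_on U"
  have "Ck n U f" if "\<forall>vs. (foldr dirder vs f) differentiable_on U" for n and f :: "'a \<Rightarrow> 'b"
    using that
  proof (induction n arbitrary: f)
    case (Suc n)
    have "f differentiable_on U" using Suc.prems[rule_format, of "[]"] by simp
    moreover have "Ck n U (dirder v f)" for v
      by (rule Suc.IH) (use Suc.prems[rule_format, of "_ @ [v]"] in simp)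
    ultimately show ?case by simp
  qed simp
  then show "\<forall>n. Ck n U f" using * by blast
qed

lemma smooth_on_Ck: "smooth_on U f \<longleftrightarrow> open U \<and> (\<forall>n. Ck n U f)"
  unfolding smooth_on_def Ck_foldr ..

lemma Ck_Suc_imp: "Ck (Suc n) U f \<Longrightarrow> Ck n U f"
  by (induction n arbitrary: f) auto

lemma has_derivative_dirder:
  assumes "f differentiable_on U" "open U" "x \<in> U"
  shows "(f has_derivative (\<lambda>v. dirder v f x)) (at x)"
  using assms unfolding dirder_def
  by (metis differentiable_on_eq_differentiable_at frechet_derivative_works eta_contract_eq)

lemma dirder_eqI: "(f has_derivative f') (at x) \<Longrightarrow> dirder v f x = f' v"
  unfolding dirder_def using frechet_derivative_at by metis

lemma dirder_cong:
  assumes "open U" "x \<in> U" "\<And>y. y \<in> U \<Longrightarrow> f y = g y"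
  shows "dirder v f x = dirder v g x"
proof -
  have "(f has_derivative F) (at x) \<longleftrightarrow> (g has_derivative F) (at x)" for F
    using assms has_derivative_transform_within_open[of f F x UNIV U g]
      has_derivative_transform_within_open[of g F x UNIV U f] by auto
  then show ?thesis unfolding dirder_def frechet_derivative_def by simp
qed

text \<open>Off the domain of differentiability \<open>dirder\<close> is an unspecified value, so
  derivative formulas hold on \<open>U\<close> only. Openness of \<open>U\<close> is what lets such
  formulas be differentiated again.\<close>

lemma Ck_cong:
  assumes "open U" "\<And>y. y \<in> U \<Longrightarrow> f y = g y"
  shows "Ck n U f \<longleftrightarrow> Ck n U g"
  using assms(2)
proof (induction n arbitrary: f g)
  case (Suc n)
  have "f differentiable_on U \<longleftrightarrow> g differentiable_on U"
    unfolding differentiable_on_def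
    using Suc.prems differentiable_transform_within[of f _ U 1 g] differentiable_transform_within[of g _ U 1 f] by fastforce
  moreover have "Ck n U (dirder v f) \<longleftrightarrow> Ck n U (dirder v g)" for v
    by (rule Suc.IH) (use Suc.prems assms(1) dirder_cong in blast)
  ultimately show ?case by simp
qed simp

text \<open>This drives the closure lemmas: supply a formula for the derivative and show that the
  formula has one order of differentiability less.\<close>

lemma Ck_SucI:
  assumes "open U" "\<And>x. x \<in> U \<Longrightarrow> (f has_derivative (\<lambda>v. f' v x)) (at x)" "\<And>v. Ck n U (f' v)"
  shows "Ck (Suc n) U f"
proof -
  have "f differentiable_on U"
    using assms(2) by (meson differentiable_at_imp_differentiable_on differentiable_def)
  moreover have "Ck n U (dirder v f)" for v
    using Ck_cong[OF assms(1), of "dirder v f" "f' v" n] assms(2,3) dirder_eqI by metis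
  ultimately show ?thesis by simp
qed

lemma Ck_SucD:
  assumes "Ck (Suc n) U f" "open U"
  shows "\<And>x. x \<in> U \<Longrightarrow> (f has_derivative (\<lambda>v. dirder v f x)) (at x)" "\<And>v. Ck n U (dirder v f)"
  using assms has_derivative_dirder by auto

section \<open>Closure of n-fold differentiability under algebra and composition\<close>

lemma Ck_const: "open U \<Longrightarrow> Ck n U (\<lambda>x. c)"
proof (induction n arbitrary: c)
  case (Suc n)
  show ?case by (rule Ck_SucI[where f' = "\<lambda>v x. 0"]) (use Suc in \<open>auto\<close>)
qed simp

lemma Ck_add: "open U \<Longrightarrow> Ck n U f \<Longrightarrow> Ck n U g \<Longrightarrow> Ck n U (\<lambda>x. f x + g x)"
proof (induction n arbitrary: f g)
  case (Suc n)
  note d = Ck_SucD[OF Suc.prems(2,1)] Ck_SucD[OF Suc.prems(3,1)]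
  show ?case
    by (rule Ck_SucI[where f' = "\<lambda>v x. dirder v f x + dirder v g x", OF Suc.prems(1)])
      (use d Suc in \<open>auto intro!: derivative_eq_intros\<close>)
qed simp

lemma Ck_bounded_linear: "open U \<Longrightarrow> bounded_linear L \<Longrightarrow> Ck n U f \<Longrightarrow> Ck n U (\<lambda>x. L (f x))"
proof (induction n arbitrary: f)
  case (Suc n)
  note d = Ck_SucD[OF Suc.prems(3,1)]
  show ?case
    by (rule Ck_SucI[where f' = "\<lambda>v x. L (dirder v f x)", OF Suc.prems(1)])
      (intro bounded_linear.has_derivative[OF Suc.prems(2)] Suc d; assumption)+
qed simp

lemma Ck_bounded_bilinear:
  assumes "bounded_bilinear P"
  shows "open U \<Longrightarrow> Ck n U f \<Longrightarrow> Ck n U g \<Longrightarrow> Ck n U (\<lambda>x. P (f x) (g x))"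
proof (induction n arbitrary: f g)
  case (Suc n)
  note d = Ck_SucD[OF Suc.prems(2,1)] Ck_SucD[OF Suc.prems(3,1)]
  show ?case
    by (rule Ck_SucI[where f' = "\<lambda>v x. P (f x) (dirder v g x) + P (dirder v f x) (g x)", OF Suc.prems(1)])
      (intro bounded_bilinear.FDERIV[OF assms] Ck_add Suc d Ck_Suc_imp[OF Suc.prems(2)] Ck_Suc_imp[OF Suc.prems(3)]; assumption)+
qed simp

lemma Ck_sum: "open U \<Longrightarrow> (\<And>i. i \<in> I \<Longrightarrow> Ck n U (f i)) \<Longrightarrow> Ck n U (\<lambda>x. \<Sum>i\<in>I. f i x)"
  by (induction I rule: infinite_finite_induct) (auto intro!: Ck_add Ck_const)

text \<open>The derivative of 1/f is built from f' and 1/f itself, so at order n the induction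
  hypothesis covers it. The square root works in the same way.\<close>

lemma Ck_inverse:
  fixes f :: "'a::euclidean_space \<Rightarrow> real"
  shows "open U \<Longrightarrow> (\<And>x. x \<in> U \<Longrightarrow> f x \<noteq> 0) \<Longrightarrow> Ck n U f \<Longrightarrow> Ck n U (\<lambda>x. inverse (f x))"
proof (induction n)
  case (Suc n)
  note d = Ck_SucD[OF Suc.prems(3,1)]
  have "Ck n U (\<lambda>x. inverse (f x))"
    by (rule Suc.IH[OF Suc.prems(1,2) Ck_Suc_imp[OF Suc.prems(3)]])
  then have "Ck n U (\<lambda>x. - (inverse (f x) * dirder v f x * inverse (f x)))" for v
    by (intro Ck_bounded_linear[OF Suc.prems(1) bounded_linear_minus[OF bounded_linear_ident]]
        Ck_bounded_bilinear[OF bounded_bilinear_mult Suc.prems(1)] d(2))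
  moreover have "((\<lambda>x. inverse (f x)) has_derivative (\<lambda>v. - (inverse (f x) * dirder v f x * inverse (f x)))) (at x)"
    if "x \<in> U" for x
    by (rule Deriv.has_derivative_inverse[OF Suc.prems(2)[OF that] d(1)[OF that]])
  ultimately show ?case
    by (intro Ck_SucI[where f' = "\<lambda>v x. - (inverse (f x) * dirder v f x * inverse (f x))", OF Suc.prems(1)])
qed simp

lemma Ck_sqrt:
  fixes f :: "'a::euclidean_space \<Rightarrow> real"
  shows "open U \<Longrightarrow> (\<And>x. x \<in> U \<Longrightarrow> f x > 0) \<Longrightarrow> Ck n U f \<Longrightarrow> Ck n U (\<lambda>x. sqrt (f x))"
proof (induction n)
  case (Suc n)
  note d = Ck_SucD[OF Suc.prems(3,1)]
  have sqrt_neq: "sqrt (f x) \<noteq> 0" if "x \<in> U" for x using Suc.prems(2)[OF that] by simp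
  have "(sqrt has_derivative (\<lambda>h. h * (inverse (sqrt (f x)) * (1/2)))) (at (f x))" if "x \<in> U" for x
    using DERIV_real_sqrt[OF Suc.prems(2)[OF that]]
    unfolding has_field_derivative_def by (rule back_subst[of "\<lambda>F. (sqrt has_derivative F) (at (f x))"]) auto
  then have "((\<lambda>x. sqrt (f x)) has_derivative (\<lambda>v. dirder v f x * (inverse (sqrt (f x)) * (1/2)))) (at x)"
    if "x \<in> U" for x
    using that has_derivative_compose[OF d(1)[OF that]] by blast
  moreover have "Ck n U (\<lambda>x. dirder v f x * (inverse (sqrt (f x)) * (1/2)))" for v
    by (intro Ck_bounded_bilinear[OF bounded_bilinear_mult Suc.prems(1)] d(2) Ck_const[OF Suc.prems(1)]
       Ck_inverse[OF Suc.prems(1) sqrt_neq] Suc.IH[OF Suc.prems(1,2) Ck_Suc_imp[OF Suc.prems(3)]])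
  ultimately show ?case
    by (intro Ck_SucI[where f' = "\<lambda>v x. dirder v f x * (inverse (sqrt (f x)) * (1/2))", OF Suc.prems(1)])
qed simp

text \<open>The chain rule differentiates g in the direction \<open>dirder v k x\<close>, which
  varies with x. Expanding this direction in the basis leaves derivatives of g in fixed directions,
  to which the induction hypothesis applies; hence g is arbitrary and k fixed.\<close>

lemma Ck_compose:
  fixes g :: "'b::euclidean_space \<Rightarrow> 'c::real_normed_vector"
  shows "open U \<Longrightarrow> open V \<Longrightarrow> k ` U \<subseteq> V \<Longrightarrow> Ck n V g \<Longrightarrow> Ck n U k \<Longrightarrow> Ck n U (\<lambda>x. g (k x))"
proof (induction n arbitrary: g)
  case (Suc n)
  note d = Ck_SucD[OF Suc.prems(4,2)] Ck_SucD[OF Suc.prems(5,1)]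
  have "((\<lambda>x. g (k x)) has_derivative (\<lambda>v. \<Sum>i\<in>Basis. (dirder v k x \<bullet> i) *\<^sub>R dirder i g (k x))) (at x)"
    if "x \<in> U" for x
  proof -
    have "k x \<in> V" using that Suc.prems by auto
    from has_derivative_compose[OF d(3)[OF that] d(1)[OF this]]
    have h: "((\<lambda>x. g (k x)) has_derivative (\<lambda>v. dirder (dirder v k x) g (k x))) (at x)" .
    have "bounded_linear (\<lambda>w. dirder w g (k x))" using d(1)[OF \<open>k x \<in> V\<close>] has_derivative_bounded_linear by blast
    then have l: "linear (\<lambda>w. dirder w g (k x))" by (rule bounded_linear.linear)
    have "dirder w g (k x) = (\<Sum>i\<in>Basis. (w \<bullet> i) *\<^sub>R dirder i g (k x))" for w
      using linear_sum[OF l, of "\<lambda>i. (w \<bullet> i) *\<^sub>R i" Basis] by (simp add: linear_cmul[OF l] euclidean_representation)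
    then have eq: "(\<lambda>v. dirder (dirder v k x) g (k x)) = (\<lambda>v. \<Sum>i\<in>Basis. (dirder v k x \<bullet> i) *\<^sub>R dirder i g (k x))"
      by blast
    show ?thesis using h unfolding eq .
  qed
  moreover have "Ck n U (\<lambda>x. \<Sum>i\<in>Basis. (dirder v k x \<bullet> i) *\<^sub>R dirder i g (k x))" for v
  proof (rule Ck_sum[OF Suc.prems(1)])
    fix i :: 'b
    have "Ck n U (\<lambda>x. dirder i g (k x))"
      by (rule Suc.IH[OF Suc.prems(1-3) d(2) Ck_Suc_imp[OF Suc.prems(5)]])
    then show "Ck n U (\<lambda>x. (dirder v k x \<bullet> i) *\<^sub>R dirder i g (k x))"
      by (rule Ck_bounded_bilinear[OF bounded_bilinear_scaleR Suc.prems(1)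
            Ck_bounded_linear[OF Suc.prems(1) bounded_linear_inner_left d(4)]])
  qed
  ultimately show ?case
    by (intro Ck_SucI[where f' = "\<lambda>v x. \<Sum>i\<in>Basis. (dirder v k x \<bullet> i) *\<^sub>R dirder i g (k x)", OF Suc.prems(1)])
qed simp

lemma smooth_on_open: "smooth_on U f \<Longrightarrow> open U"
  and smooth_on_imp_Ck: "smooth_on U f \<Longrightarrow> Ck n U f"
  by (auto simp: smooth_on_Ck)

lemma smooth_on_const: "open U \<Longrightarrow> smooth_on U (\<lambda>x. c)"
  by (simp add: smooth_on_Ck Ck_const)

lemma smooth_on_cong: "smooth_on U f \<Longrightarrow> (\<And>y. y \<in> U \<Longrightarrow> f y = g y) \<Longrightarrow> smooth_on U g"
  using Ck_cong by (metis smooth_on_Ck)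

lemma smooth_on_bounded_linear: "bounded_linear L \<Longrightarrow> smooth_on U f \<Longrightarrow> smooth_on U (\<lambda>x. L (f x))"
  by (simp add: smooth_on_Ck Ck_bounded_linear)

lemma smooth_on_bounded_bilinear:
  "bounded_bilinear P \<Longrightarrow> smooth_on U f \<Longrightarrow> smooth_on U g \<Longrightarrow> smooth_on U (\<lambda>x. P (f x) (g x))"
  by (simp add: smooth_on_Ck Ck_bounded_bilinear)

lemma smooth_on_add: "smooth_on U f \<Longrightarrow> smooth_on U g \<Longrightarrow> smooth_on U (\<lambda>x. f x + g x)"
  by (simp add: smooth_on_Ck Ck_add)

lemma smooth_on_sum:
  "open U \<Longrightarrow> (\<And>i. i \<in> I \<Longrightarrow> smooth_on U (f i)) \<Longrightarrow> smooth_on U (\<lambda>x. \<Sum>i\<in>I. f i x)"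
  by (simp add: smooth_on_Ck Ck_sum)

lemmas smooth_on_minus = smooth_on_bounded_linear[OF bounded_linear_minus[OF bounded_linear_ident]]
lemmas smooth_on_mult = smooth_on_bounded_bilinear[OF bounded_bilinear_mult[where ?'a = real]]
lemmas smooth_on_scaleR = smooth_on_bounded_bilinear[OF bounded_bilinear_scaleR]
lemmas smooth_on_inner = smooth_on_bounded_bilinear[OF bounded_bilinear_inner]

lemma smooth_on_diff: "smooth_on U f \<Longrightarrow> smooth_on U g \<Longrightarrow> smooth_on U (\<lambda>x. f x - g x)"
  using smooth_on_add[OF _ smooth_on_minus] by fastforce

lemma smooth_on_inverse:
  fixes f :: "'a::euclidean_space \<Rightarrow> real"
  shows "smooth_on U f \<Longrightarrow> (\<And>x. x \<in> U \<Longrightarrow> f x \<noteq> 0) \<Longrightarrow> smooth_on U (\<lambda>x. inverse (f x))"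
  by (simp add: smooth_on_Ck Ck_inverse)

lemma smooth_on_sqrt:
  fixes f :: "'a::euclidean_space \<Rightarrow> real"
  shows "smooth_on U f \<Longrightarrow> (\<And>x. x \<in> U \<Longrightarrow> f x > 0) \<Longrightarrow> smooth_on U (\<lambda>x. sqrt (f x))"
  by (simp add: smooth_on_Ck Ck_sqrt)

lemma smooth_on_compose:
  fixes g :: "'b::euclidean_space \<Rightarrow> 'c::real_normed_vector"
  shows "smooth_on V g \<Longrightarrow> smooth_on U k \<Longrightarrow> k ` U \<subseteq> V \<Longrightarrow> smooth_on U (\<lambda>x. g (k x))"
  unfolding smooth_on_Ck using Ck_compose by blast

lemma smooth_on_linear:
  fixes L :: "'a::euclidean_space \<Rightarrow> 'b::real_normed_vector"
  assumes "open U" "bounded_linear L"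
  shows "smooth_on U L"
proof -
  have "Ck n U L" for n
  proof (cases n)
    case (Suc m)
    show ?thesis unfolding Suc
      by (rule Ck_SucI[where f' = "\<lambda>v x. L v"])
        (use assms Ck_const bounded_linear_imp_has_derivative in auto)
  qed simp
  then show ?thesis using assms smooth_on_Ck by blast
qed

lemma smooth_on_dirder: "smooth_on U f \<Longrightarrow> smooth_on U (dirder v f)"
  unfolding smooth_on_Ck using Ck.simps(2) by blast

lemma smooth_on_has_derivative:
  "smooth_on U f \<Longrightarrow> x \<in> U \<Longrightarrow> (f has_derivative (\<lambda>v. dirder v f x)) (at x)"
  using has_derivative_dirder[of f U x] smooth_on_imp_Ck[of U f 1] smooth_on_open by auto

lemma linear_dirder: "smooth_on U f \<Longrightarrow> x \<in> U \<Longrightarrow> linear (\<lambda>v. dirder v f x)"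
  using smooth_on_has_derivative has_derivative_bounded_linear bounded_linear.linear by blast

lemma dirder_euclidean:
  fixes f :: "'a::euclidean_space \<Rightarrow> 'b::real_normed_vector"
  assumes "smooth_on U f" "x \<in> U"
  shows "dirder w f x = (\<Sum>i\<in>Basis. (w \<bullet> i) *\<^sub>R dirder i f x)"
  using linear_sum[OF linear_dirder[OF assms], of "\<lambda>i. (w \<bullet> i) *\<^sub>R i" Basis]
  by (simp add: linear_cmul[OF linear_dirder[OF assms]] euclidean_representation)

lemma smooth_on_continuous_on: "smooth_on U f \<Longrightarrow> continuous_on U f"
  using smooth_on_imp_Ck[of U f 1] differentiable_imp_continuous_on by auto

section \<open>Symmetry of second derivatives\<close>

lemma dirder_line:
  fixes f :: "'a::euclidean_space \<Rightarrow> real"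
  assumes "smooth_on U f" "p + s *\<^sub>R v \<in> U"
  shows "((\<lambda>s. f (p + s *\<^sub>R v)) has_real_derivative dirder v f (p + s *\<^sub>R v)) (at s)"
proof -
  have "((\<lambda>s. p + s *\<^sub>R v) has_derivative (\<lambda>h. h *\<^sub>R v)) (at s)"
    by (auto intro!: derivative_eq_intros)
  from has_derivative_compose[OF this smooth_on_has_derivative[OF assms]]
  show ?thesis
    unfolding has_field_derivative_def
    by (rule back_subst[of "\<lambda>F. (_ has_derivative F) (at s)"])
      (auto simp: linear_cmul[OF linear_dirder[OF assms]])
qed

text \<open>Two mean value steps: one along v for the difference of two parallel segments, one along
  w for the resulting difference of first derivatives. The ball contains the whole
  parallelogram.\<close>

lemma second_difference_mvt:
  fixes f :: "'a::euclidean_space \<Rightarrow> real"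
  assumes f: "smooth_on U f" and h: "h > 0" and sub: "cball x (h * (norm v + norm w)) \<subseteq> U"
  shows "\<exists>y \<in> cball x (h * (norm v + norm w)).
    f (x + h *\<^sub>R v + h *\<^sub>R w) - f (x + h *\<^sub>R v) - f (x + h *\<^sub>R w) + f x = h\<^sup>2 * dirder w (dirder v f) y"
proof -
  have in_ball: "x + \<xi> *\<^sub>R v + \<eta> *\<^sub>R w \<in> cball x (h * (norm v + norm w))"
    if "0 \<le> \<xi>" "\<xi> \<le> h" "0 \<le> \<eta>" "\<eta> \<le> h" for \<xi> \<eta>
  proof -
    have "norm (\<xi> *\<^sub>R v + \<eta> *\<^sub>R w) \<le> \<xi> * norm v + \<eta> * norm w"
      using norm_triangle_ineq[of "\<xi> *\<^sub>R v" "\<eta> *\<^sub>R w"] that by simp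
    also have "\<dots> \<le> h * norm v + h * norm w"
      using that by (intro add_mono mult_right_mono) auto
    also have "norm (\<xi> *\<^sub>R v + \<eta> *\<^sub>R w) = dist x (x + \<xi> *\<^sub>R v + \<eta> *\<^sub>R w)"
      by (subst dist_commute) (simp add: dist_norm add.assoc)
    finally show ?thesis
      by (simp add: distrib_left)
  qed
  let ?\<phi> = "\<lambda>s. f ((x + h *\<^sub>R w) + s *\<^sub>R v) - f (x + s *\<^sub>R v)"
  have d1: "(?\<phi> has_real_derivative
      dirder v f ((x + h *\<^sub>R w) + s *\<^sub>R v) - dirder v f (x + s *\<^sub>R v)) (at s)" if "0 \<le> s" "s \<le> h" for s
  proof (intro DERIV_diff dirder_line[OF f])
    have "x + h *\<^sub>R w + s *\<^sub>R v = x + s *\<^sub>R v + h *\<^sub>R w" by (simp add: add_ac)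
    then show "x + h *\<^sub>R w + s *\<^sub>R v \<in> U"
      using subsetD[OF sub in_ball[OF that, of h]] h by (simp only: less_imp_le order_refl)
    show "x + s *\<^sub>R v \<in> U"
      using subsetD[OF sub in_ball[OF that, of 0]] h by simp
  qed
  then obtain \<xi> where \<xi>: "0 < \<xi>" "\<xi> < h"
    "?\<phi> h - ?\<phi> 0 = (h - 0) * (dirder v f ((x + h *\<^sub>R w) + \<xi> *\<^sub>R v) - dirder v f (x + \<xi> *\<^sub>R v))"
    using MVT2[OF h d1] by blast
  let ?\<psi> = "\<lambda>r. dirder v f ((x + \<xi> *\<^sub>R v) + r *\<^sub>R w)"
  have d2: "(?\<psi> has_real_derivative dirder w (dirder v f) ((x + \<xi> *\<^sub>R v) + r *\<^sub>R w)) (at r)"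
    if "0 \<le> r" "r \<le> h" for r
    by (rule dirder_line[OF smooth_on_dirder[OF f]])
      (use in_ball[of \<xi> r] that \<xi> sub in fastforce)
  then obtain \<eta> where \<eta>: "0 < \<eta>" "\<eta> < h"
    "?\<psi> h - ?\<psi> 0 = (h - 0) * dirder w (dirder v f) ((x + \<xi> *\<^sub>R v) + \<eta> *\<^sub>R w)"
    using MVT2[OF h d2] by blast
  show ?thesis
  proof (rule bexI)
    show "x + \<xi> *\<^sub>R v + \<eta> *\<^sub>R w \<in> cball x (h * (norm v + norm w))"
      using in_ball \<xi> \<eta> by simp
    have e: "dirder v f ((x + h *\<^sub>R w) + \<xi> *\<^sub>R v) - dirder v f (x + \<xi> *\<^sub>R v) = ?\<psi> h - ?\<psi> 0"
      by (simp add: add_ac)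
    show "f (x + h *\<^sub>R v + h *\<^sub>R w) - f (x + h *\<^sub>R v) - f (x + h *\<^sub>R w) + f x
      = h\<^sup>2 * dirder w (dirder v f) (x + \<xi> *\<^sub>R v + \<eta> *\<^sub>R w)"
      using \<xi>(3) unfolding e \<eta>(3) by (simp add: algebra_simps power2_eq_square)
  qed
qed

text \<open>The second difference is symmetric in v and w, so it is h^2 times either mixed
  derivative, each at some point near x. Continuity of both at x rules out different values.\<close>

lemma dirder_commute_real:
  fixes f :: "'a::euclidean_space \<Rightarrow> real"
  assumes f: "smooth_on U f" and x: "x \<in> U"
  shows "dirder w (dirder v f) x = dirder v (dirder w f) x"
proof (rule ccontr)
  let ?g = "dirder w (dirder v f)" and ?k = "dirder v (dirder w f)"
  let ?C = "norm v + norm w"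
  assume ne: "?g x \<noteq> ?k x"
  define e where "e = \<bar>?g x - ?k x\<bar> / 2"
  have e: "e > 0" using ne by (simp add: e_def)
  have U: "open U" using f smooth_on_open by blast
  have c: "isCont ?g x" "isCont ?k x"
    using smooth_on_continuous_on[OF smooth_on_dirder[OF smooth_on_dirder[OF f]]] U x
      continuous_on_eq_continuous_at by blast+
  obtain d1 where d1: "d1 > 0" "\<And>y. dist y x < d1 \<Longrightarrow> dist (?g y) (?g x) < e"
    using c(1) e unfolding continuous_at_eps_delta by blast
  obtain d2 where d2: "d2 > 0" "\<And>y. dist y x < d2 \<Longrightarrow> dist (?k y) (?k x) < e"
    using c(2) e unfolding continuous_at_eps_delta by blast
  obtain d3 where d3: "d3 > 0" "ball x d3 \<subseteq> U" using U x open_contains_ball by blast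
  define d where "d = min d1 (min d2 d3)"
  \<comment> \<open>The summand 1 keeps the denominator positive when v = w = 0 and makes the radius
    h * C strictly smaller than d.\<close>
  define h where "h = d / (?C + 1)"
  have pos: "d > 0" "?C \<ge> 0" using d1 d2 d3 by (auto simp: d_def)
  have h: "h > 0" unfolding h_def by (rule divide_pos_pos) (use pos in linarith)+
  have "h * ?C < h * (?C + 1)" using h by simp
  also have "\<dots> = d" unfolding h_def using pos(2) by (simp add: add_nonneg_eq_0_iff)
  finally have hC: "h * ?C < d" .
  have ball: "dist y x < d" if "y \<in> cball x (h * ?C)" for y
    using that hC by (simp add: dist_commute)
  then have sub: "cball x (h * ?C) \<subseteq> U"
    using d3 by (force simp: d_def dist_commute)
  obtain y where y: "y \<in> cball x (h * ?C)"
    "f (x + h *\<^sub>R v + h *\<^sub>R w) - f (x + h *\<^sub>R v) - f (x + h *\<^sub>R w) + f x = h\<^sup>2 * ?g y"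
    using second_difference_mvt[OF f h sub] by blast
  have "cball x (h * (norm w + norm v)) \<subseteq> U" using sub by (simp add: add.commute)
  from second_difference_mvt[OF f h this]
  obtain y' where y': "y' \<in> cball x (h * ?C)"
    "f (x + h *\<^sub>R w + h *\<^sub>R v) - f (x + h *\<^sub>R w) - f (x + h *\<^sub>R v) + f x = h\<^sup>2 * ?k y'"
    by (auto simp: add.commute)
  have "f (x + h *\<^sub>R w + h *\<^sub>R v) = f (x + h *\<^sub>R v + h *\<^sub>R w)" by (simp add: algebra_simps)
  then have "h\<^sup>2 * ?g y = h\<^sup>2 * ?k y'" using y(2) y'(2) by linarith
  then have "?g y = ?k y'" using h by simp
  moreover have "dist (?g y) (?g x) < e" "dist (?k y') (?k x) < e"
    using d1(2) d2(2) ball y(1) y'(1) by (auto simp: d_def)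
  ultimately show False by (auto simp: e_def dist_real_def abs_if split: if_splits)
qed

section \<open>Derivative rules for smooth maps and variable directions\<close>

lemma dirder_bounded_linear:
  assumes "bounded_linear L" "smooth_on U f" "x \<in> U"
  shows "dirder v (\<lambda>y. L (f y)) x = L (dirder v f x)"
  by (rule dirder_eqI[OF bounded_linear.has_derivative[OF assms(1) smooth_on_has_derivative[OF assms(2,3)]]])

lemma dirder_bounded_bilinear:
  assumes "bounded_bilinear P" "smooth_on U f" "smooth_on U g" "x \<in> U"
  shows "dirder v (\<lambda>y. P (f y) (g y)) x = P (f x) (dirder v g x) + P (dirder v f x) (g x)"
  by (rule dirder_eqI[OF bounded_bilinear.FDERIV[OF assms(1) smooth_on_has_derivative[OF assms(2,4)]
         smooth_on_has_derivative[OF assms(3,4)]]])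

lemma dirder_sum:
  assumes "\<And>i. i \<in> I \<Longrightarrow> smooth_on U (f i)" "x \<in> U"
  shows "dirder v (\<lambda>y. \<Sum>i\<in>I. f i y) x = (\<Sum>i\<in>I. dirder v (f i) x)"
  by (rule dirder_eqI, rule has_derivative_sum) (use assms smooth_on_has_derivative in blast)

lemma dirder_commute:
  fixes f :: "'a::euclidean_space \<Rightarrow> 'b::euclidean_space"
  assumes f: "smooth_on U f" and x: "x \<in> U"
  shows "dirder w (dirder v f) x = dirder v (dirder w f) x"
proof (rule euclidean_eqI)
  fix i :: 'b
  note L = bounded_linear_inner_left[of i]
  have U: "open U" using f smooth_on_open by blast
  have "dirder w (dirder v (\<lambda>y. f y \<bullet> i)) x = dirder w (\<lambda>y. dirder v f y \<bullet> i) x" for v w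
    by (rule dirder_cong[OF U x]) (rule dirder_bounded_linear[OF L f])
  then have "dirder w (dirder v f) x \<bullet> i = dirder w (dirder v (\<lambda>y. f y \<bullet> i)) x" for v w
    by (simp only: dirder_bounded_linear[OF L smooth_on_dirder[OF f] x])
  then show "dirder w (dirder v f) x \<bullet> i = dirder v (dirder w f) x \<bullet> i"
    by (simp only: dirder_commute_real[OF smooth_on_bounded_linear[OF L f] x, of w v])
qed

lemma smooth_on_dirder_field:
  fixes g :: "'a::euclidean_space \<Rightarrow> 'b::euclidean_space"
  assumes b: "smooth_on U b" and g: "smooth_on U g"
  shows "smooth_on U (\<lambda>z. dirder (b z) g z)"
proof (rule smooth_on_cong)
  show "smooth_on U (\<lambda>z. \<Sum>i\<in>Basis. (b z \<bullet> i) *\<^sub>R dirder i g z)"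
    by (intro smooth_on_sum smooth_on_scaleR smooth_on_bounded_linear[OF bounded_linear_inner_left]
        smooth_on_dirder b g smooth_on_open[OF b])
qed (simp add: dirder_euclidean[OF g, symmetric])

lemma dirder_dirder_field:
  fixes g :: "'a::euclidean_space \<Rightarrow> 'b::euclidean_space"
  assumes b: "smooth_on U b" and g: "smooth_on U g" and z: "z \<in> U"
  shows "dirder w (\<lambda>z. dirder (b z) g z) z = dirder (dirder w b z) g z + dirder w (dirder (b z) g) z"
proof -
  have U: "open U" using b smooth_on_open by blast
  note bi = smooth_on_bounded_linear[OF bounded_linear_inner_left b]
  have *: "dirder w (\<lambda>z. dirder (c z) g z) z
      = (\<Sum>i\<in>Basis. (c z \<bullet> i) *\<^sub>R dirder w (dirder i g) z + (dirder w c z \<bullet> i) *\<^sub>R dirder i g z)"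
    if c: "smooth_on U c" for c
  proof -
    note ci = smooth_on_bounded_linear[OF bounded_linear_inner_left c]
    have "dirder w (\<lambda>z. dirder (c z) g z) z = dirder w (\<lambda>z. \<Sum>i\<in>Basis. (c z \<bullet> i) *\<^sub>R dirder i g z) z"
      by (rule dirder_cong[OF U z]) (rule dirder_euclidean[OF g])
    also have "\<dots> = (\<Sum>i\<in>Basis. dirder w (\<lambda>z. (c z \<bullet> i) *\<^sub>R dirder i g z) z)"
      by (rule dirder_sum[OF _ z]) (intro smooth_on_scaleR ci smooth_on_dirder g)
    also have "\<dots> = (\<Sum>i\<in>Basis. (c z \<bullet> i) *\<^sub>R dirder w (dirder i g) z + (dirder w c z \<bullet> i) *\<^sub>R dirder i g z)"
      by (intro sum.cong refl)
        (simp add: dirder_bounded_bilinear[OF bounded_bilinear_scaleR ci smooth_on_dirder[OF g] z]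
         dirder_bounded_linear[OF bounded_linear_inner_left c z])
    finally show ?thesis .
  qed
  have c0: "dirder w (\<lambda>z. b x) z = 0" for x
    by (rule dirder_eqI) simp
  show ?thesis
    using *[OF b] *[OF smooth_on_const[OF U, of "b z"]]
    by (simp add: dirder_euclidean[OF g z, of "dirder w b z"] c0 sum.distrib)
qed

lemma smooth_on_Pair:
  fixes f :: "'a::euclidean_space \<Rightarrow> 'b::real_normed_vector" and g :: "'a \<Rightarrow> 'c::real_normed_vector"
  assumes "smooth_on U f" "smooth_on U g"
  shows "smooth_on U (\<lambda>x. (f x, g x))"
proof -
  have "bounded_linear (\<lambda>x::'b. (x, 0::'c))" "bounded_linear (\<lambda>x::'c. (0::'b, x))"
    by (auto intro: bounded_linear_Pair bounded_linear_ident bounded_linear_zero)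
  then have "smooth_on U (\<lambda>x. (f x, 0) + (0, g x))"
    by (intro smooth_on_add smooth_on_bounded_linear[of "\<lambda>x. (x, 0)"] smooth_on_bounded_linear[of "\<lambda>x. (0, x)"] assms)
  then show ?thesis by simp
qed

lemma dirder_compose:
  assumes "smooth_on V g" "smooth_on U k" "k ` U \<subseteq> V" "x \<in> U"
  shows "dirder v (\<lambda>y. g (k y)) x = dirder (dirder v k x) g (k x)"
proof -
  have "k x \<in> V" using assms by auto
  then show ?thesis
    by (rule dirder_eqI[OF has_derivative_compose[OF smooth_on_has_derivative[OF assms(2,4)]
            smooth_on_has_derivative[OF assms(1)]]])
qed

lemma dirder_add:
  assumes "smooth_on U f" "smooth_on U g" "x \<in> U"
  shows "dirder v (\<lambda>y. f y + g y) x = dirder v f x + dirder v g x"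
  by (rule dirder_eqI[OF has_derivative_add[OF smooth_on_has_derivative[OF assms(1,3)]
         smooth_on_has_derivative[OF assms(2,3)]]])

lemma dirder_const: "dirder v (\<lambda>y. c) x = 0"
  by (rule dirder_eqI) simp

lemma dirder_linear: "bounded_linear L \<Longrightarrow> dirder v L x = L v"
  by (rule dirder_eqI) (rule bounded_linear_imp_has_derivative)

lemma dirder_Pair:
  assumes "smooth_on U f" "smooth_on U g" "x \<in> U"
  shows "dirder v (\<lambda>y. (f y, g y)) x = (dirder v f x, dirder v g x)"
  by (rule dirder_eqI[OF has_derivative_Pair[OF smooth_on_has_derivative[OF assms(1,3)]
         smooth_on_has_derivative[OF assms(2,3)]]])

text \<open>If c were positive, the derivative would be positive just to the right of 0, and the
  mean value theorem would give a value above the maximum.\<close>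

lemma second_derivative_local_max:
  fixes \<phi> :: "real \<Rightarrow> real"
  assumes d: "d > 0" and \<phi>: "\<And>r. \<bar>r\<bar> < d \<Longrightarrow> (\<phi> has_real_derivative \<phi>' r) (at r)"
    and \<phi>': "(\<phi>' has_real_derivative c) (at 0)" and max: "\<And>r. \<bar>r\<bar> < d \<Longrightarrow> \<phi> r \<le> \<phi> 0"
  shows "\<phi>' 0 = 0" "c \<le> 0"
proof -
  show 0: "\<phi>' 0 = 0"
    using DERIV_local_max[OF \<phi>[of 0] d] d max by auto
  show "c \<le> 0"
  proof (rule ccontr)
    assume "\<not> c \<le> 0"
    then obtain d' where d': "d' > 0" "\<And>h. 0 < h \<Longrightarrow> h < d' \<Longrightarrow> \<phi>' 0 < \<phi>' (0 + h)"
      using DERIV_pos_inc_right[OF \<phi>'] by auto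
    define h where "h = min d d' / 2"
    have h: "0 < h" "h < d" "h < d'" using d d' by (auto simp: h_def)
    obtain \<xi> where \<xi>: "0 < \<xi>" "\<xi> < h" "\<phi> h - \<phi> 0 = (h - 0) * \<phi>' \<xi>"
      using MVT2[OF h(1), of \<phi> \<phi>'] \<phi> h by auto
    have "\<phi>' \<xi> > 0" using d'(2)[of \<xi>] \<xi> h 0 by simp
    then have "\<phi> h > \<phi> 0" using \<xi>(3) h by (smt (verit) mult_pos_pos)
    then show False using max[of h] h by simp
  qed
qed

section \<open>Commuting vector fields dual to a local diffeomorphism\<close>

text \<open>\<open>B V\<close> is the pull-back of the constant field V under \<Theta>, so
  differentiating along it is partial differentiation in the coordinates \<Theta>. Only the
  differential of \<Theta> is inverted, never \<Theta> itself.\<close>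

locale moving_frame =
  fixes W :: "'a::euclidean_space set" and \<Theta> :: "'a \<Rightarrow> 'a" and B :: "'a \<Rightarrow> 'a \<Rightarrow> 'a"
  assumes smooth_\<Theta>: "smooth_on W \<Theta>" and smooth_B: "smooth_on W (B V)"
    and dirder_B: "z \<in> W \<Longrightarrow> dirder (B V z) \<Theta> z = V"
    and dirder_inj: "z \<in> W \<Longrightarrow> dirder v \<Theta> z = 0 \<Longrightarrow> v = 0"
begin

definition DD :: "'a \<Rightarrow> ('a \<Rightarrow> 'b::euclidean_space) \<Rightarrow> 'a \<Rightarrow> 'b" where
  "DD V g = (\<lambda>z. dirder (B V z) g z)"

lemma open_W: "open W" using smooth_\<Theta> smooth_on_open by blast

lemma B_eqI: "z \<in> W \<Longrightarrow> dirder v \<Theta> z = V \<Longrightarrow> B V z = v"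
  using dirder_inj[of z "B V z - v"] dirder_B[of z V]
    linear_diff[OF linear_dirder[OF smooth_\<Theta>], of z "B V z" v] by simp

lemma linear_B: assumes "z \<in> W" shows "linear (\<lambda>V. B V z)"
  by (rule linearI; rule B_eqI[OF assms])
    (simp_all add: dirder_B[OF assms] linear_add[OF linear_dirder[OF smooth_\<Theta> assms]]
      linear_cmul[OF linear_dirder[OF smooth_\<Theta> assms]])

lemma linear_DD: "smooth_on W g \<Longrightarrow> z \<in> W \<Longrightarrow> linear (\<lambda>V. DD V g z)"
  using linear_compose[OF linear_B linear_dirder] unfolding DD_def o_def by blast

lemma smooth_on_DD: "smooth_on W g \<Longrightarrow> smooth_on W (DD V g)"
  unfolding DD_def by (rule smooth_on_dirder_field[OF smooth_B])

lemma DD_cong: "z \<in> W \<Longrightarrow> (\<And>y. y \<in> W \<Longrightarrow> f y = g y) \<Longrightarrow> DD V f z = DD V g z"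
  unfolding DD_def using dirder_cong[OF open_W] by blast

lemma DD_const: "DD V (\<lambda>z. c) z = 0"
  unfolding DD_def by (rule dirder_eqI) simp

lemma DD_bounded_linear:
  "bounded_linear L \<Longrightarrow> smooth_on W f \<Longrightarrow> z \<in> W \<Longrightarrow> DD V (\<lambda>y. L (f y)) z = L (DD V f z)"
  unfolding DD_def by (rule dirder_bounded_linear)

lemma DD_bounded_bilinear:
  "bounded_bilinear P \<Longrightarrow> smooth_on W f \<Longrightarrow> smooth_on W g \<Longrightarrow> z \<in> W \<Longrightarrow>
    DD V (\<lambda>y. P (f y) (g y)) z = P (f z) (DD V g z) + P (DD V f z) (g z)"
  unfolding DD_def by (rule dirder_bounded_bilinear)

lemma DD_add:
  assumes "smooth_on W f" "smooth_on W g" "z \<in> W"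
  shows "DD V (\<lambda>y. f y + g y) z = DD V f z + DD V g z"
  unfolding DD_def by (rule dirder_add[OF assms])

lemmas DD_mult = DD_bounded_bilinear[OF bounded_bilinear_mult[where ?'a = real]]
lemmas DD_inner = DD_bounded_bilinear[OF bounded_bilinear_inner]
lemmas DD_inner_const = DD_bounded_linear[OF bounded_linear_inner_left]

text \<open>Differentiating d\<Theta>(B V) = V along B V' shows that d\<Theta> sends the derivative
  of B V along B V' to minus the second derivative of \<Theta> in both fields. That is symmetric, so
  by injectivity of d\<Theta> the Lie bracket vanishes. The remaining second derivatives of g have
  frozen directions and commute.\<close>

lemma DD_commute:
  fixes g :: "'a \<Rightarrow> 'b::euclidean_space"
  assumes g: "smooth_on W g" and z: "z \<in> W"
  shows "DD V (DD V' g) z = DD V' (DD V g) z"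
proof -
  have *: "dirder (dirder w (B V) z) \<Theta> z = - dirder w (dirder (B V z) \<Theta>) z" for w V
  proof -
    have "dirder w (\<lambda>z. dirder (B V z) \<Theta> z) z = dirder w (\<lambda>z. V) z"
      by (rule dirder_cong[OF open_W z]) (rule dirder_B)
    also have "\<dots> = 0" by (rule dirder_eqI) simp
    finally have "dirder (dirder w (B V) z) \<Theta> z + dirder w (dirder (B V z) \<Theta>) z = 0"
      unfolding dirder_dirder_field[OF smooth_B[of V] smooth_\<Theta> z, of w] .
    then show ?thesis by (rule eq_neg_iff_add_eq_0[THEN iffD2])
  qed
  have "dirder (dirder (B V z) (B V') z) \<Theta> z = dirder (dirder (B V' z) (B V) z) \<Theta> z"
    unfolding * dirder_commute[OF smooth_\<Theta> z, of "B V z" "B V' z"] ..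
  then have "B (dirder (dirder (B V z) (B V') z) \<Theta> z) z = dirder (B V' z) (B V) z"
    by (rule B_eqI[OF z sym])
  moreover have "B (dirder (dirder (B V z) (B V') z) \<Theta> z) z = dirder (B V z) (B V') z"
    by (rule B_eqI[OF z refl])
  ultimately have e: "dirder (B V z) (B V') z = dirder (B V' z) (B V) z"
    by (rule trans[OF sym, rotated])
  have 1: "DD V (DD V' g) z = dirder (dirder (B V z) (B V') z) g z + dirder (B V z) (dirder (B V' z) g) z" for V V'
    using dirder_dirder_field[OF smooth_B[of V'] g z, of "B V z"] unfolding DD_def .
  show ?thesis
    unfolding 1 e dirder_commute[OF g z, of "B V z" "B V' z"] ..
qed

text \<open>Value, first and second derivative along one field, bundled so that repeated Leibniz
  expansions become arithmetic with triples.\<close>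

definition jet :: "'a \<Rightarrow> 'a \<Rightarrow> ('a \<Rightarrow> real) \<Rightarrow> real \<Rightarrow> real \<Rightarrow> real \<Rightarrow> bool" where
  "jet z V f c0 c1 c2 \<longleftrightarrow> z \<in> W \<and> smooth_on W f \<and> f z = c0 \<and> DD V f z = c1 \<and> DD V (DD V f) z = c2"

lemma jetI: "z \<in> W \<Longrightarrow> smooth_on W f \<Longrightarrow> jet z V f (f z) (DD V f z) (DD V (DD V f) z)"
  by (simp add: jet_def)

lemma jet_const: assumes "z \<in> W" shows "jet z V (\<lambda>z. c) c 0 0"
proof -
  have "DD V (DD V (\<lambda>z. c)) z = DD V (\<lambda>z. 0) z"
    by (rule DD_cong[OF assms]) (rule DD_const)
  then show ?thesis using assms by (simp add: jet_def smooth_on_const open_W DD_const)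
qed

lemma jet_add:
  assumes f: "jet z V f f0 f1 f2" and g: "jet z V g g0 g1 g2"
  shows "jet z V (\<lambda>z. f z + g z) (f0 + g0) (f1 + g1) (f2 + g2)"
proof -
  note f' = f[unfolded jet_def] and g' = g[unfolded jet_def]
  have z: "z \<in> W" and s: "smooth_on W f" "smooth_on W g" using f' g' by blast+
  have "DD V (DD V (\<lambda>z. f z + g z)) z = DD V (\<lambda>z. DD V f z + DD V g z) z"
    by (rule DD_cong[OF z]) (rule DD_add[OF s])
  then show ?thesis
    using f' g' by (simp add: jet_def smooth_on_add DD_add[OF s z] DD_add[OF smooth_on_DD smooth_on_DD z])
qed

lemma jet_mult:
  assumes f: "jet z V f f0 f1 f2" and g: "jet z V g g0 g1 g2"
  shows "jet z V (\<lambda>z. f z * g z) (f0 * g0) (f0 * g1 + f1 * g0) (f0 * g2 + 2 * f1 * g1 + f2 * g0)"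
proof -
  note f' = f[unfolded jet_def] and g' = g[unfolded jet_def]
  have z: "z \<in> W" and s: "smooth_on W f" "smooth_on W g" using f' g' by blast+
  note d = smooth_on_DD[OF s(1), of V] smooth_on_DD[OF s(2), of V]
  have "DD V (DD V (\<lambda>z. f z * g z)) z = DD V (\<lambda>z. f z * DD V g z + DD V f z * g z) z"
    by (rule DD_cong[OF z]) (rule DD_mult[OF s])
  also have "\<dots> = DD V (\<lambda>z. f z * DD V g z) z + DD V (\<lambda>z. DD V f z * g z) z"
    by (rule DD_add[OF smooth_on_mult[OF s(1) d(2)] smooth_on_mult[OF d(1) s(2)] z])
  also have "\<dots> = f0 * g2 + 2 * f1 * g1 + f2 * g0"
    using f' g' by (simp add: DD_mult[OF s(1) d(2) z] DD_mult[OF d(1) s(2) z])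
  finally show ?thesis
    using f' g' by (simp add: jet_def smooth_on_mult DD_mult[OF s z])
qed

lemma jet_eqI:
  "jet z V f c0 c1 c2 \<Longrightarrow> c0 = d0 \<Longrightarrow> c1 = d1 \<Longrightarrow> c2 = d2 \<Longrightarrow> jet z V f d0 d1 d2"
  by simp

lemma jet_cong:
  assumes g: "jet z V g c0 c1 c2" and eq: "\<And>y. y \<in> W \<Longrightarrow> f y = g y"
  shows "jet z V f c0 c1 c2"
proof -
  note g' = g[unfolded jet_def]
  have z: "z \<in> W" using g' by blast
  have 1: "DD V f y = DD V g y" if "y \<in> W" for y by (rule DD_cong[OF that]) (rule eq)
  have "DD V (DD V f) z = DD V (DD V g) z" by (rule DD_cong[OF z]) (rule 1)
  moreover have "smooth_on W f" using smooth_on_cong[of W g f] g' eq by auto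
  ultimately show ?thesis using g' 1 eq by (simp add: jet_def)
qed

end

section \<open>Linear algebra in three dimensions\<close>

unbundle cross3_syntax

text \<open>Cramer's rule with cofactors written as cross products. An explicit inverse of a 3 by 3
  matrix makes its smooth dependence on the entries visible.\<close>

lemma cramer_cross3:
  fixes c1 c2 c3 v :: "real^3"
  shows "(c1 \<bullet> (c2 \<times> c3)) *\<^sub>R v = (v \<bullet> (c2 \<times> c3)) *\<^sub>R c1 + (v \<bullet> (c3 \<times> c1)) *\<^sub>R c2 + (v \<bullet> (c1 \<times> c2)) *\<^sub>R c3"
  unfolding vec_eq_iff forall_3 by (simp add: cross3_simps)

lemma triple_product_eq_0D:
  fixes c1 c2 c3 :: "real^3"
  assumes "c1 \<bullet> (c2 \<times> c3) = 0"
  shows "\<exists>a::real^3. a \<noteq> 0 \<and> (a$1) *\<^sub>R c1 + (a$2) *\<^sub>R c2 + (a$3) *\<^sub>R c3 = 0"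
proof -
  define M :: "real^3^3" where "M = transpose (vector [c1, c2, c3])"
  have "det M = 0"
    using assms by (simp add: M_def dot_cross_det det_transpose)
  moreover have "det M \<noteq> 0 \<longleftrightarrow> inj ((*v) M)"
    using det_nz_iff_inj[OF matrix_vector_mul_linear, of M] by (simp only: matrix_of_matrix_vector_mul)
  ultimately obtain a where "a \<noteq> 0" "M *v a = 0"
    using linear_injective_0[OF matrix_vector_mul_linear, of M] by blast
  then show ?thesis
    by (intro exI[of _ a])
      (simp add: M_def vec_eq_iff forall_3 matrix_vector_mult_def transpose_def sum_3 vector_3 mult.commute)
qed

lemma bounded_bilinear_cross3: "bounded_bilinear cross3"
  using bilinear_cross bilinear_conv_bounded_bilinear by blast

definition orthonormal3 :: "real^3 \<Rightarrow> real^3 \<Rightarrow> real^3 \<Rightarrow> bool" where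
  "orthonormal3 e1 e2 e3 \<longleftrightarrow> e1 \<bullet> e1 = 1 \<and> e2 \<bullet> e2 = 1 \<and> e3 \<bullet> e3 = 1 \<and>
     e1 \<bullet> e2 = 0 \<and> e1 \<bullet> e3 = 0 \<and> e2 \<bullet> e3 = 0"

lemma orthonormal3_expand:
  assumes "orthonormal3 e1 e2 e3"
  shows "v = (v \<bullet> e1) *\<^sub>R e1 + (v \<bullet> e2) *\<^sub>R e2 + (v \<bullet> e3) *\<^sub>R e3"
proof -
  note o = assms[unfolded orthonormal3_def]
  have ne: "e1 \<noteq> 0" "e2 \<noteq> 0" "e3 \<noteq> 0" "e1 \<noteq> e2" "e1 \<noteq> e3" "e2 \<noteq> e3" using o by auto
  have "pairwise orthogonal {e1, e2, e3}"
    using o by (auto simp: pairwise_def orthogonal_def inner_commute)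
  then have "independent {e1, e2, e3}"
    using ne by (intro pairwise_orthogonal_independent) auto
  moreover have "card {e1, e2, e3} = 3" using ne by simp
  ultimately have span: "span {e1, e2, e3} = UNIV"
    using card_ge_dim_independent[of "{e1, e2, e3}" UNIV] by (auto simp: dim_UNIV)
  \<comment> \<open>The remainder is orthogonal to the frame, hence to its span, which is the whole
    space; so it is orthogonal to itself.\<close>
  let ?r = "v - ((v \<bullet> e1) *\<^sub>R e1 + (v \<bullet> e2) *\<^sub>R e2 + (v \<bullet> e3) *\<^sub>R e3)"
  have "e \<bullet> ?r = 0" if "e \<in> {e1, e2, e3}" for e
    using that o by (auto simp: algebra_simps inner_commute)
  then have "orthogonal ?r w" if "w \<in> span {e1, e2, e3}" for w
    by (intro orthogonal_to_span[OF that]) (auto simp: orthogonal_def inner_commute)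
  then have "?r \<bullet> ?r = 0" unfolding span orthogonal_def by blast
  then show ?thesis by simp
qed

lemma orthonormal3_inner:
  assumes "orthonormal3 e1 e2 e3"
  shows "v \<bullet> w = (v \<bullet> e1) * (w \<bullet> e1) + (v \<bullet> e2) * (w \<bullet> e2) + (v \<bullet> e3) * (w \<bullet> e3)"
  by (subst orthonormal3_expand[OF assms, of w]) (simp add: inner_add_right)

text \<open>Rotating a test frame of the orthogonal complement of \<open>n\<close> by a quarter turn flips the sign of
  its off-diagonal entry, so some intermediate rotation diagonalises \<open>A\<close>.\<close>
lemma selfadjoint_eigenframe:
  fixes A :: "real^3 \<Rightarrow> real^3"
  assumes lin: "linear A" and sym: "\<And>v w. A v \<bullet> w = v \<bullet> A w" and n: "n \<bullet> n = 1" "A n = 0"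
  obtains m1 m2 \<mu>1 \<mu>2 where "orthonormal3 m1 m2 n" "A m1 = \<mu>1 *\<^sub>R m1" "A m2 = \<mu>2 *\<^sub>R m2"
proof -
  obtain y where "y \<noteq> 0" "orthogonal n y"
    using orthogonal_to_vector_exists[of n] by auto
  define e1 where "e1 = y /\<^sub>R norm y"
  define e2 where "e2 = n \<times> e1"
  have e1: "e1 \<bullet> e1 = 1" "n \<bullet> e1 = 0"
    using \<open>y \<noteq> 0\<close> \<open>orthogonal n y\<close>
    by (simp_all add: e1_def orthogonal_def dot_square_norm power2_eq_square)
  have "(norm e2)\<^sup>2 = 1"
    using norm_cross_dot[of n e1] e1 n by (simp add: e2_def norm_eq_sqrt_inner)
  then have e2: "e2 \<bullet> e2 = 1" "n \<bullet> e2 = 0" "e1 \<bullet> e2 = 0"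
    by (simp_all add: dot_square_norm) (simp_all add: e2_def dot_cross_self)
  let ?m1 = "\<lambda>\<theta>. cos \<theta> *\<^sub>R e1 + sin \<theta> *\<^sub>R e2" and ?m2 = "\<lambda>\<theta>. cos \<theta> *\<^sub>R e2 - sin \<theta> *\<^sub>R e1"
  have A_comb: "A (r *\<^sub>R v + q *\<^sub>R w) = r *\<^sub>R A v + q *\<^sub>R A w" for r q v w
    by (simp add: linear_add[OF lin] linear_cmul[OF lin])
  have "\<exists>\<theta>\<ge>0. \<theta> \<le> pi/2 \<and> A (?m1 \<theta>) \<bullet> ?m2 \<theta> = 0"
  proof -
    have cont: "continuous_on {0..pi/2} (\<lambda>\<theta>. A (?m1 \<theta>) \<bullet> ?m2 \<theta>)"
      unfolding A_comb by (intro continuous_intros)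
    have "A (?m1 (pi/2)) \<bullet> ?m2 (pi/2) = - (A (?m1 0) \<bullet> ?m2 0)"
      using sym[of e2 e1] by (simp add: inner_commute)
    then show ?thesis
      using IVT'[OF _ _ _ cont, of 0] IVT2'[OF _ _ _ cont, of 0] pi_ge_zero by fastforce
  qed
  then obtain \<theta> where off: "A (?m1 \<theta>) \<bullet> ?m2 \<theta> = 0" by blast
  have [simp]: "n \<bullet> n = 1" "e1 \<bullet> e1 = 1" "e2 \<bullet> e2 = 1" "n \<bullet> e1 = 0" "e1 \<bullet> n = 0" "n \<bullet> e2 = 0"
    "e2 \<bullet> n = 0" "e1 \<bullet> e2 = 0" "e2 \<bullet> e1 = 0"
    using n e1 e2 by (simp_all add: inner_commute)
  have o: "orthonormal3 (?m1 \<theta>) (?m2 \<theta>) n"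
    unfolding orthonormal3_def
    by (simp add: inner_add_left inner_add_right inner_diff_left inner_diff_right flip: power2_eq_square)
  have An: "A v \<bullet> n = 0" for v using sym[of v n] n by simp
  have "A (?m1 \<theta>) = (A (?m1 \<theta>) \<bullet> ?m1 \<theta>) *\<^sub>R ?m1 \<theta>"
    by (subst orthonormal3_expand[OF o]) (simp only: off An scaleR_zero_left add_0_right)
  moreover have "A (?m2 \<theta>) \<bullet> ?m1 \<theta> = 0" using off sym by (simp only: inner_commute)
  then have "A (?m2 \<theta>) = (A (?m2 \<theta>) \<bullet> ?m2 \<theta>) *\<^sub>R ?m2 \<theta>"
    by (subst orthonormal3_expand[OF o]) (simp only: An scaleR_zero_left add_0_right add_0_left)
  ultimately show ?thesis using that o by blast
qed

unbundle no cross3_syntax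

text \<open>The algebra at a spatial maximum in an eigenframe. The letters stand for derivatives of
  h: p, q are h_11, h_22; a1, a2 are h_111, h_122; b1, b2 are h_112, h_222; F1, F2, F3 are h_1111,
  h_1122, h_2222. \<open>\<psi>1\<close> and \<open>\<psi>2\<close> are the second derivatives of
  the speed along the two eigenvectors. The critical point equations divide by p - q, and for p = q
  the conclusion is trivial.\<close>

lemma gap_decrease:
  fixes p q :: real
  assumes "p > 0" "q > 0"
    and G1: "(p - q) * (a1 - a2) / 2 = 0" and G2: "(p - q) * (b1 - b2) / 2 = 0"
    and G11: "2 * ((p - q)\<^sup>2 / 4) + ((a1\<^sup>2 + p * F1) + (a2\<^sup>2 + q * F2) + 2 * (b1\<^sup>2 + p\<^sup>2))
          - ((a1 + a2)\<^sup>2 + (p + q) * (F1 + F2 + 2 * p)) / 2 \<le> 0"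
    and G22: "2 * ((p - q)\<^sup>2 / 4) + ((b1\<^sup>2 + p * F2) + (b2\<^sup>2 + q * F3) + 2 * (a2\<^sup>2 + q\<^sup>2))
          - ((b1 + b2)\<^sup>2 + (p + q) * (F2 + F3 + 2 * q)) / 2 \<le> 0"
    and P1: "\<psi>1 = 3 * (p * q) + ((a1 + a2)\<^sup>2 + (p + q) * (F1 + F2 + 2 * p))
          - ((a1\<^sup>2 + p * F1) + (a2\<^sup>2 + q * F2) + 2 * (b1\<^sup>2 + p\<^sup>2))"
    and P2: "\<psi>2 = 3 * (p * q) + ((b1 + b2)\<^sup>2 + (p + q) * (F2 + F3 + 2 * q))
          - ((b1\<^sup>2 + p * F2) + (b2\<^sup>2 + q * F3) + 2 * (a2\<^sup>2 + q\<^sup>2))"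
  shows "(p - q) * (\<psi>1 - \<psi>2) / 2 \<le> 0"
proof (cases "p = q")
  case False
  then have ab: "a1 = a2" "b1 = b2" using G1 G2 by auto
  let ?G1 = "2 * ((p - q)\<^sup>2 / 4) + ((a1\<^sup>2 + p * F1) + (a2\<^sup>2 + q * F2) + 2 * (b1\<^sup>2 + p\<^sup>2))
          - ((a1 + a2)\<^sup>2 + (p + q) * (F1 + F2 + 2 * p)) / 2"
  let ?G2 = "2 * ((p - q)\<^sup>2 / 4) + ((b1\<^sup>2 + p * F2) + (b2\<^sup>2 + q * F3) + 2 * (a2\<^sup>2 + q\<^sup>2))
          - ((b1 + b2)\<^sup>2 + (p + q) * (F2 + F3 + 2 * q)) / 2"
  \<comment> \<open>The weights q and p remove F1, F2 and F3. What remains is \<open>C\<close>,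
    which is 2 (p + q) G, and the gradient terms in \<open>D\<close>.\<close>
  define A where "A = q * ?G1"
  define B where "B = p * ?G2"
  define C where "C = (p - q)\<^sup>2 / 2 * (p + q)"
  define D where "D = p * b1\<^sup>2 + q * a1\<^sup>2"
  have "A \<le> 0" "B \<le> 0"
    using mult_nonneg_nonpos[of q ?G1] mult_nonneg_nonpos[of p ?G2] G11 G22 assms(1,2)
    unfolding A_def B_def by auto
  moreover have "0 \<le> C" "0 \<le> D"
    using assms(1,2) unfolding C_def D_def by auto
  moreover have "(p - q) * (\<psi>1 - \<psi>2) / 2 = A + B - C - 2 * D"
    unfolding P1 P2 ab A_def B_def C_def D_def by (simp add: field_simps power2_eq_square)
  ultimately show ?thesis by linarith
qed simp

section \<open>The flow by the inverse Gauss curvature\<close>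

locale gauss_flow =
  fixes X N :: "real^3 \<Rightarrow> real \<Rightarrow> real^3" and a b :: real and U :: "((real^3) \<times> real) set"
  assumes U: "S2 \<times> {a<..<b} \<subseteq> U"
    and smooth_X: "smooth_on U (\<lambda>(x, t). X x t)"
    and smooth_N: "smooth_on U (\<lambda>(x, t). N x t)"
    and convex: "\<And>t. t \<in> {a<..<b} \<Longrightarrow> closed_strictly_convex_surface X N t"
    and flow: "\<And>u t. u \<in> S2 \<Longrightarrow> t \<in> {a<..<b} \<Longrightarrow>
           ((\<lambda>s. X u s) has_vector_derivative (1 / gaussK X N u t) *\<^sub>R N u t) (at t)"
begin

section \<open>Radial extension of the embedding and its normal\<close>

definition W :: "((real^3) \<times> real) set" where "W = (- {0}) \<times> {a<..<b}"
definition s :: "(real^3) \<times> real \<Rightarrow> real" where "s z = norm (fst z)"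
definition dir :: "(real^3) \<times> real \<Rightarrow> real^3" where "dir z = fst z /\<^sub>R s z"
text \<open>Off the sphere the given X and N are arbitrary smooth extensions. Composing with
  \<open>dir\<close> replaces them by the 0-homogeneous ones, so that full derivatives see only
  tangential data; \<open>Y\<close> then extends the Gauss map 1-homogeneously.\<close>

definition Xh :: "(real^3) \<times> real \<Rightarrow> real^3" where "Xh z = X (dir z) (snd z)"
definition Nh :: "(real^3) \<times> real \<Rightarrow> real^3" where "Nh z = N (dir z) (snd z)"
definition Y :: "(real^3) \<times> real \<Rightarrow> real^3" where "Y z = s z *\<^sub>R Nh z"
definition tproj :: "(real^3) \<times> real \<Rightarrow> real^3 \<Rightarrow> real^3" where
  "tproj z w = w - (w \<bullet> dir z) *\<^sub>R dir z"

lemma open_W: "open W" unfolding W_def by (intro open_Times) auto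

lemma s_pos: "z \<in> W \<Longrightarrow> s z > 0" by (auto simp: W_def s_def)

lemma s_dir: "z \<in> W \<Longrightarrow> s z *\<^sub>R dir z = fst z" using s_pos[of z] by (simp add: dir_def)

lemma dir_sphere: assumes "z \<in> W" shows "dir z \<in> S2" "dir z \<bullet> dir z = 1"
proof -
  show "dir z \<in> S2" using s_pos[OF assms] by (simp add: dir_def s_def)
  then show "dir z \<bullet> dir z = 1" by (simp add: dot_square_norm)
qed

lemma snd_W: "z \<in> W \<Longrightarrow> snd z \<in> {a<..<b}" by (auto simp: W_def)

lemma tproj_tangent: "z \<in> W \<Longrightarrow> tproj z w \<in> tangent (dir z)"
  by (simp add: tangent_def tproj_def inner_diff_left dir_sphere)

lemma tproj_id: "w \<bullet> dir z = 0 \<Longrightarrow> tproj z w = w"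
  by (simp add: tproj_def)

lemma smooth_fst: "smooth_on W fst" and smooth_snd: "smooth_on W snd"
  by (intro smooth_on_linear open_W bounded_linear_fst bounded_linear_snd)+

lemma smooth_s: "smooth_on W s"
proof (rule smooth_on_cong)
  show "smooth_on W (\<lambda>z. sqrt (fst z \<bullet> fst z))"
    by (intro smooth_on_sqrt smooth_on_inner smooth_fst) (auto simp: W_def)
qed (simp add: s_def norm_eq_sqrt_inner)

lemma smooth_dir: "smooth_on W dir"
  unfolding dir_def[abs_def]
  by (intro smooth_on_scaleR smooth_on_inverse smooth_s smooth_fst) (use s_pos in force)

lemma smooth_dir_snd: "smooth_on W (\<lambda>z. (dir z, snd z))"
  by (intro smooth_on_Pair smooth_dir smooth_snd)

lemma dir_snd_image: "(\<lambda>z. (dir z, snd z)) ` W \<subseteq> U"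
  using U dir_sphere snd_W by blast

lemma smooth_Xh: "smooth_on W Xh"
  using smooth_on_compose[OF smooth_X smooth_dir_snd dir_snd_image] by (simp add: Xh_def[abs_def])

lemma smooth_Nh: "smooth_on W Nh"
  using smooth_on_compose[OF smooth_N smooth_dir_snd dir_snd_image] by (simp add: Nh_def[abs_def])

lemma smooth_Y: "smooth_on W Y"
  unfolding Y_def[abs_def] by (intro smooth_on_scaleR smooth_s smooth_Nh)

lemma dirder_s: assumes z: "z \<in> W" shows "dirder V s z = fst V \<bullet> dir z"
proof -
  \<comment> \<open>Differentiating s^2 = |x|^2 avoids the derivative of the norm; the direction
    field is treated likewise through s * dir = x.\<close>
  have "dirder V (\<lambda>z. s z * s z) z = dirder V (\<lambda>z. fst z \<bullet> fst z) z"
    by (simp add: s_def norm_eq_sqrt_inner)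
  then have "2 * (s z * dirder V s z) = 2 * (fst V \<bullet> fst z)"
    by (simp add: dirder_bounded_bilinear[OF bounded_bilinear_mult smooth_s smooth_s z]
        dirder_bounded_bilinear[OF bounded_bilinear_inner smooth_fst smooth_fst z]
        dirder_linear[OF bounded_linear_fst] inner_commute)
  then show ?thesis using s_pos[OF z] by (simp add: dir_def field_simps)
qed

lemma dirder_dir: assumes z: "z \<in> W" shows "dirder V dir z = tproj z (fst V) /\<^sub>R s z"
proof -
  have "dirder V (\<lambda>z. s z *\<^sub>R dir z) z = dirder V fst z"
    by (rule dirder_cong[OF open_W z]) (rule s_dir)
  then have "s z *\<^sub>R dirder V dir z + (fst V \<bullet> dir z) *\<^sub>R dir z = fst V"
    by (simp add: dirder_bounded_bilinear[OF bounded_bilinear_scaleR smooth_s smooth_dir z]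
        dirder_linear[OF bounded_linear_fst] dirder_s[OF z])
  then have "s z *\<^sub>R dirder V dir z = tproj z (fst V)"
    by (simp add: tproj_def algebra_simps)
  then have "(s z *\<^sub>R dirder V dir z) /\<^sub>R s z = tproj z (fst V) /\<^sub>R s z" by simp
  then show ?thesis using s_pos[OF z] by simp
qed

lemma dX_dirder:
  assumes F: "smooth_on U (\<lambda>(x, t). F x t)" and z: "u \<in> S2" "t \<in> {a<..<b}"
  shows "dirder (v, 0) (\<lambda>(x, t). F x t) (u, t) = dX F u t v"
proof -
  have "(u, t) \<in> U" using U z by auto
  have "((\<lambda>x. (x, t)) has_derivative (\<lambda>v. (v, 0))) (at u)"
    by (auto intro!: derivative_eq_intros)
  from has_derivative_compose[OF this smooth_on_has_derivative[OF F \<open>(u, t) \<in> U\<close>]]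
  have "((\<lambda>x. F x t) has_derivative (\<lambda>v. dirder (v, 0) (\<lambda>(x, t). F x t) (u, t))) (at u)" by simp
  then show ?thesis unfolding dX_def by (subst frechet_derivative_at[symmetric]) auto
qed

text \<open>The derivative of \<open>dir\<close> projects to the tangent plane and divides by s.
  Thus only values of \<open>dX\<close> on tangent vectors occur, the ones on which
  \<open>princ_curvs\<close> is based.\<close>

lemma dirder_dir_compose:
  assumes F: "smooth_on U (\<lambda>(x, t). F x t)" and z: "z \<in> W"
  shows "dirder (w, 0) (\<lambda>z. F (dir z) (snd z)) z = dX F (dir z) (snd z) (tproj z w) /\<^sub>R s z"
    and "dirder (0, 1) (\<lambda>z. F (dir z) (snd z)) z = dirder (0, 1) (\<lambda>(x, t). F x t) (dir z, snd z)"
    and "linear (dX F (dir z) (snd z))"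
proof -
  let ?F = "\<lambda>(x, t). F x t"
  have in_U: "(dir z, snd z) \<in> U" using dir_snd_image z by blast
  have *: "dirder V (\<lambda>z. F (dir z) (snd z)) z = dirder (tproj z (fst V) /\<^sub>R s z, snd V) ?F (dir z, snd z)" for V
    using dirder_compose[OF F smooth_dir_snd dir_snd_image z, of V]
    by (simp add: dirder_Pair[OF smooth_dir smooth_snd z] dirder_dir[OF z] dirder_linear[OF bounded_linear_snd])
  have dXF: "dX F (dir z) (snd z) = (\<lambda>v. dirder (v, 0) ?F (dir z, snd z))"
    by (rule ext) (rule dX_dirder[OF F dir_sphere(1)[OF z] snd_W[OF z], symmetric])
  have "linear (\<lambda>v. (v, 0 :: real))" by (rule linearI) auto
  from linear_compose[OF this linear_dirder[OF F in_U]]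
  show lin: "linear (dX F (dir z) (snd z))" unfolding dXF o_def .
  show "dirder (w, 0) (\<lambda>z. F (dir z) (snd z)) z = dX F (dir z) (snd z) (tproj z w) /\<^sub>R s z"
    unfolding * linear_cmul[OF lin, symmetric] unfolding dXF by simp
  show "dirder (0, 1) (\<lambda>z. F (dir z) (snd z)) z = dirder (0, 1) ?F (dir z, snd z)"
    unfolding * by (simp add: tproj_def)
qed

lemmas dirder_Xh = dirder_dir_compose(1)[OF smooth_X, folded Xh_def]
lemmas dirder_Nh = dirder_dir_compose(1)[OF smooth_N, folded Nh_def]

lemma dirder_Xh_time:
  assumes z: "z \<in> W"
  shows "dirder (0, 1) Xh z = (1 / gaussK X N (dir z) (snd z)) *\<^sub>R Nh z"
proof -
  let ?F = "\<lambda>(x, t). X x t"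
  have in_U: "(dir z, snd z) \<in> U" using dir_snd_image z by blast
  have "((\<lambda>t. (dir z, t)) has_derivative (\<lambda>h. (0, h))) (at (snd z))"
    by (auto intro!: derivative_eq_intros)
  from has_derivative_compose[OF this smooth_on_has_derivative[OF smooth_X in_U]]
  have "((\<lambda>t. X (dir z) t) has_derivative (\<lambda>h. dirder (0, h) ?F (dir z, snd z))) (at (snd z))" by simp
  moreover have "((\<lambda>t. X (dir z) t) has_derivative (\<lambda>h. h *\<^sub>R (1 / gaussK X N (dir z) (snd z)) *\<^sub>R Nh z)) (at (snd z))"
    using flow[OF dir_sphere(1)[OF z] snd_W[OF z]] unfolding has_vector_derivative_def Nh_def .
  ultimately have "(\<lambda>h. dirder (0, h) ?F (dir z, snd z)) = (\<lambda>h. h *\<^sub>R (1 / gaussK X N (dir z) (snd z)) *\<^sub>R Nh z)"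
    by (rule has_derivative_unique)
  from fun_cong[OF this, of 1] show ?thesis
    using dirder_dir_compose(2)[OF smooth_X z] unfolding Xh_def[abs_def] by simp
qed

lemma surface:
  assumes z: "z \<in> W"
  shows "Nh z \<bullet> Nh z = 1" "v \<in> tangent (dir z) \<Longrightarrow> Nh z \<bullet> dX X (dir z) (snd z) v = 0"
    "lam \<in> princ_curvs X N (dir z) (snd z) \<Longrightarrow> lam > 0"
    "v \<in> tangent (dir z) \<Longrightarrow> v \<noteq> 0 \<Longrightarrow> dX X (dir z) (snd z) v \<noteq> 0"
  using convex[OF snd_W[OF z]] dir_sphere(1)[OF z]
  unfolding closed_strictly_convex_surface_def Nh_def by (auto simp: dot_square_norm)

lemma Nh_orthogonal: assumes z: "z \<in> W" shows "dirder V Nh z \<bullet> Nh z = 0" 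
proof -
  have "dirder V (\<lambda>z. Nh z \<bullet> Nh z) z = dirder V (\<lambda>z. 1) z"
    by (rule dirder_cong[OF open_W z]) (rule surface(1))
  then show ?thesis
    by (simp add: dirder_bounded_bilinear[OF bounded_bilinear_inner smooth_Nh smooth_Nh z] dirder_const inner_commute)
qed

lemma Xh_orthogonal: assumes z: "z \<in> W" shows "dirder (w, 0) Xh z \<bullet> Nh z = 0"
  using surface(2)[OF z tproj_tangent[OF z]] by (simp add: dirder_Xh[OF z] inner_commute)

text \<open>The differential of \<open>Y\<close> sends the radial direction to the normal and acts
  on tangent vectors as dN. As dN is orthogonal to N, the normal component of the image recovers the
  radial component of w.\<close>

lemma dirder_Y:
  assumes z: "z \<in> W"
  shows "dirder (w, 0) Y z = (w \<bullet> dir z) *\<^sub>R Nh z + dX N (dir z) (snd z) (tproj z w)"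
    and "dirder (w, 0) Y z \<bullet> Nh z = w \<bullet> dir z"
proof -
  have *: "dirder (w, 0) Y z = (w \<bullet> dir z) *\<^sub>R Nh z + s z *\<^sub>R dirder (w, 0) Nh z"
    unfolding Y_def[abs_def]
    by (simp add: dirder_bounded_bilinear[OF bounded_bilinear_scaleR smooth_s smooth_Nh z] dirder_s[OF z])
  show "dirder (w, 0) Y z = (w \<bullet> dir z) *\<^sub>R Nh z + dX N (dir z) (snd z) (tproj z w)"
    using s_pos[OF z] unfolding * by (simp add: dirder_Nh[OF z])
  show "dirder (w, 0) Y z \<bullet> Nh z = w \<bullet> dir z"
    unfolding * by (simp add: inner_add_left Nh_orthogonal[OF z] surface(1)[OF z])
qed

text \<open>A kernel vector has no radial part, so it is a tangent vector with dN w = 0. That makes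
  0 a principal curvature, against strict convexity.\<close>

lemma dirder_Y_inj:
  assumes z: "z \<in> W" and 0: "dirder (w, 0) Y z = 0"
  shows "w = 0"
proof (rule ccontr)
  assume "w \<noteq> 0"
  have w: "w \<bullet> dir z = 0" using dirder_Y(2)[OF z, of w] 0 by simp
  then have "dX N (dir z) (snd z) w = 0" using dirder_Y(1)[OF z, of w] 0 by (simp add: tproj_id)
  then have "0 \<in> princ_curvs X N (dir z) (snd z)"
    using w \<open>w \<noteq> 0\<close> unfolding princ_curvs_def tangent_def by auto
  then show False using surface(3)[OF z] by blast
qed

section \<open>The frame dual to the extended Gauss map and time\<close>

definition \<Theta> :: "(real^3) \<times> real \<Rightarrow> (real^3) \<times> real" where "\<Theta> z = (Y z, snd z)"
definition col :: "3 \<Rightarrow> (real^3) \<times> real \<Rightarrow> real^3" where "col i = dirder (axis i 1, 0) Y"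
definition vol :: "(real^3) \<times> real \<Rightarrow> real" where "vol z = col 1 z \<bullet> (cross3 (col 2 z) (col 3 z))"
text \<open>Cramer's formula for the inverse of the spatial differential of \<open>Y\<close>, the
  matrix with columns \<open>col 1\<close>, \<open>col 2\<close>, \<open>col 3\<close> and
  determinant \<open>vol\<close>.\<close>

definition Binv :: "real^3 \<Rightarrow> (real^3) \<times> real \<Rightarrow> real^3" where
  "Binv v z = inverse (vol z) *\<^sub>R ((v \<bullet> (cross3 (col 2 z) (col 3 z))) *\<^sub>R axis 1 1
     + (v \<bullet> (cross3 (col 3 z) (col 1 z))) *\<^sub>R axis 2 1 + (v \<bullet> (cross3 (col 1 z) (col 2 z))) *\<^sub>R axis 3 1)"
text \<open>Inverse of the block triangular differential of (Y, t). The subtracted term compensates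
  the motion of the normal: along \<open>B (0, 1)\<close> time advances at unit rate while
  \<open>Y\<close> is stationary.\<close>

definition B :: "(real^3) \<times> real \<Rightarrow> (real^3) \<times> real \<Rightarrow> (real^3) \<times> real" where
  "B V z = (Binv (fst V) z - snd V *\<^sub>R Binv (dirder (0, 1) Y z) z, snd V)"

lemma linear_dirder_space:
  assumes F: "smooth_on W F" and z: "z \<in> W" shows "linear (\<lambda>w. dirder (w, 0) F z)"
proof -
  have "linear (\<lambda>v. (v, 0 :: real))" by (rule linearI) auto
  from linear_compose[OF this linear_dirder[OF F z]] show ?thesis unfolding o_def .
qed

lemma dirder_split:
  assumes F: "smooth_on W F" and z: "z \<in> W"
  shows "dirder (w, \<tau>) F z = dirder (w, 0) F z + \<tau> *\<^sub>R dirder (0, 1) F z"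
  using linear_add[OF linear_dirder[OF F z], of "(w, 0)" "(0, \<tau>)"]
    linear_cmul[OF linear_dirder[OF F z], of \<tau> "(0, 1)"] by simp

lemma dirder_Y_cols:
  assumes z: "z \<in> W"
  shows "dirder (r1 *\<^sub>R axis 1 1 + r2 *\<^sub>R axis 2 1 + r3 *\<^sub>R axis 3 1, 0) Y z
    = r1 *\<^sub>R col 1 z + r2 *\<^sub>R col 2 z + r3 *\<^sub>R col 3 z"
  unfolding col_def
  by (simp add: linear_add[OF linear_dirder_space[OF smooth_Y z]] linear_cmul[OF linear_dirder_space[OF smooth_Y z]])

lemma vol_nonzero: assumes z: "z \<in> W" shows "vol z \<noteq> 0"
proof
  assume "vol z = 0"
  then obtain c :: "real^3" where c: "c \<noteq> 0" "c$1 *\<^sub>R col 1 z + c$2 *\<^sub>R col 2 z + c$3 *\<^sub>R col 3 z = 0"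
    using triple_product_eq_0D unfolding vol_def by blast
  have "c$1 *\<^sub>R axis 1 1 + c$2 *\<^sub>R axis 2 1 + c$3 *\<^sub>R axis 3 1 = (0 :: real^3)"
    using c(2) dirder_Y_cols[OF z, of "c$1" "c$2" "c$3"] dirder_Y_inj[OF z] by simp
  then have "c = 0" by (simp add: vec_eq_iff forall_3 axis_def)
  then show False using c(1) by simp
qed

lemma dirder_Binv: assumes z: "z \<in> W" shows "dirder (Binv v z, 0) Y z = v"
  using vol_nonzero[OF z] cramer_cross3[of "col 1 z" "col 2 z" "col 3 z" v]
  unfolding Binv_def linear_cmul[OF linear_dirder_space[OF smooth_Y z]] dirder_Y_cols[OF z] vol_def[symmetric]
  by (metis inverse_eq_divide left_inverse real_vector.scale_one scaleR_scaleR)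

lemma smooth_col: "smooth_on W (col i)"
  unfolding col_def by (intro smooth_on_dirder smooth_Y)

lemma smooth_Binv: assumes v: "smooth_on W v" shows "smooth_on W (\<lambda>z. Binv (v z) z)"
  unfolding Binv_def[abs_def] vol_def
  by (intro smooth_on_scaleR smooth_on_inverse smooth_on_add smooth_on_inner smooth_col v
      smooth_on_const open_W smooth_on_bounded_bilinear[OF bounded_bilinear_cross3] vol_nonzero[unfolded vol_def])

lemma dirder_Theta: "z \<in> W \<Longrightarrow> dirder V \<Theta> z = (dirder V Y z, snd V)"
  unfolding \<Theta>_def[abs_def]
  by (simp add: dirder_Pair[OF smooth_Y smooth_snd] dirder_linear[OF bounded_linear_snd])

sublocale moving_frame W \<Theta> B
proof
  show "smooth_on W \<Theta>" unfolding \<Theta>_def[abs_def] by (intro smooth_on_Pair smooth_Y smooth_snd)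
  show "smooth_on W (B V)" for V
    unfolding B_def[abs_def]
    by (intro smooth_on_Pair smooth_on_diff smooth_Binv smooth_on_scaleR smooth_on_const open_W smooth_on_dirder smooth_Y)
  show "dirder (B V z) \<Theta> z = V" if z: "z \<in> W" for V z
  proof -
    note lin = linear_dirder_space[OF smooth_Y z]
    have "dirder (B V z) Y z = dirder (Binv (fst V) z - snd V *\<^sub>R Binv (dirder (0, 1) Y z) z, 0) Y z
        + snd V *\<^sub>R dirder (0, 1) Y z"
      unfolding B_def by (rule dirder_split[OF smooth_Y z])
    also have "\<dots> = fst V"
      by (simp add: linear_diff[OF lin] linear_cmul[OF lin] dirder_Binv[OF z])
    finally show ?thesis
      unfolding dirder_Theta[OF z] by (simp add: B_def)
  qed
  show "V = 0" if z: "z \<in> W" and 0: "dirder V \<Theta> z = 0" for V z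
  proof -
    have "snd V = 0" "dirder V Y z = 0" using 0 unfolding dirder_Theta[OF z] zero_prod_def by simp_all
    then show ?thesis using dirder_Y_inj[OF z, of "fst V"] by (cases V) (auto simp: zero_prod_def)
  qed
qed

section \<open>The support function, its gradient, Hessian and time derivative\<close>

definition H :: "(real^3) \<times> real \<Rightarrow> real" where "H z = Xh z \<bullet> Y z"
text \<open>Here \<open>H\<close> is the 1-homogeneous support function s <X, N>, not the mean
  curvature. \<open>hess\<close> is its Hessian with respect to the coordinate Y, and
  \<open>speed\<close> below its time derivative at fixed Y.\<close>

definition hess :: "real^3 \<Rightarrow> real^3 \<Rightarrow> (real^3) \<times> real \<Rightarrow> real" where
  "hess v w = DD (v, 0) (DD (w, 0) H)"
definition speed :: "(real^3) \<times> real \<Rightarrow> real" where "speed = DD (0, 1) H"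
definition gap :: "(real^3) \<times> real \<Rightarrow> real" where
  "gap z = (let l1 = lam1 X N (dir z) (snd z); l2 = lam2 X N (dir z) (snd z)
     in (l1 - l2)\<^sup>2 / (4 * l1\<^sup>2 * l2\<^sup>2))"

lemma smooth_H: "smooth_on W H"
  unfolding H_def[abs_def] by (intro smooth_on_inner smooth_Xh smooth_Y)

lemma smooth_hess: "smooth_on W (hess v w)"
  unfolding hess_def by (intro smooth_on_DD smooth_H)

lemma B_space: "z \<in> W \<Longrightarrow> dirder (w, 0) Y z = v \<Longrightarrow> B (v, 0) z = (w, 0)"
  by (rule B_eqI) (simp_all add: dirder_Theta)

lemma B_space_ex: assumes "z \<in> W" obtains w where "B (v, 0) z = (w, 0)" "dirder (w, 0) Y z = v"
proof -
  have "snd (B (v, 0) z) = 0" "dirder (B (v, 0) z) Y z = v"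
    using dirder_B[OF assms, of "(v, 0)"] unfolding dirder_Theta[OF assms] by auto
  then show ?thesis using that[of "fst (B (v, 0) z)"] by (metis prod.collapse)
qed

lemma B_time_ex: assumes "z \<in> W" obtains w where "B (0, 1) z = (w, 1)"
  by (simp add: B_def)

lemma DD_Y: "z \<in> W \<Longrightarrow> DD V Y z = fst V"
  using dirder_B[of z V] unfolding DD_def by (simp add: dirder_Theta prod_eq_iff)

lemma Y_inner: "z \<in> W \<Longrightarrow> Y z \<bullet> Y z = s z * s z"
  by (simp add: Y_def surface)

lemma Xh_orthogonal_Y: "z \<in> W \<Longrightarrow> dirder (w, 0) Xh z \<bullet> Y z = 0"
  by (simp add: Y_def Xh_orthogonal)

lemma DD_Xh_orthogonal: assumes z: "z \<in> W" shows "DD (v, 0) Xh z \<bullet> Nh z = 0" "DD (v, 0) Xh z \<bullet> Y z = 0"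
  by (rule B_space_ex[OF z, of v]; simp add: DD_def Xh_orthogonal[OF z] Xh_orthogonal_Y[OF z])+

text \<open>The gradient of the support function is the point X: in the product rule for <X, Y> the
  term <DX, Y> drops out, since DX is tangent to the surface.\<close>

lemma DD_H: "z \<in> W \<Longrightarrow> DD (v, 0) H z = Xh z \<bullet> v"
  unfolding H_def[abs_def]
  by (simp add: DD_inner[OF smooth_Xh smooth_Y] DD_Y DD_Xh_orthogonal)

text \<open>The dual time field has a spatial part w, but it moves X tangentially and is invisible
  to Y. Only the normal velocity 1/K is left, times s.\<close>

lemma speed_eq: assumes z: "z \<in> W" shows "speed z = s z / gaussK X N (dir z) (snd z)"
proof -
  obtain w where w: "B (0, 1) z = (w, 1)" using B_time_ex[OF z] by blast
  have "DD (0, 1) Xh z \<bullet> Y z = (1 / gaussK X N (dir z) (snd z)) * (Nh z \<bullet> Y z)"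
    unfolding DD_def w dirder_split[OF smooth_Xh z, of w 1]
    by (simp add: inner_add_left Xh_orthogonal_Y[OF z] dirder_Xh_time[OF z])
  then show ?thesis
    unfolding speed_def H_def[abs_def]
    by (simp add: DD_inner[OF smooth_Xh smooth_Y z] DD_Y[OF z]) (simp add: Y_def surface(1)[OF z])
qed

text \<open>Since the gradient is X, the Hessian is the derivative of X as a function of the normal,
  at s = 1 the inverse of the Weingarten map.\<close>

lemma hess_eq: assumes z: "z \<in> W" shows "hess v w z = DD (v, 0) Xh z \<bullet> w"
proof -
  have "hess v w z = DD (v, 0) (\<lambda>z. Xh z \<bullet> w) z"
    unfolding hess_def by (rule DD_cong[OF z]) (rule DD_H)
  then show ?thesis by (simp add: DD_inner_const[OF smooth_Xh z])
qed

lemma hess_sym: "z \<in> W \<Longrightarrow> hess v w z = hess w v z"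
  unfolding hess_def by (rule DD_commute[OF smooth_H])

section \<open>The spectrum of D^2 h and the principal curvatures\<close>

lemma linear_DD_Xh: assumes z: "z \<in> W" shows "linear (\<lambda>v. DD (v, 0) Xh z)"
proof -
  have "linear (\<lambda>v. (v, 0 :: real))" by (rule linearI) auto
  from linear_compose[OF this linear_DD[OF smooth_Xh z]] show ?thesis unfolding o_def .
qed

text \<open>Moving Y in the direction of the normal is moving x along its ray, where X is constant.
  This is the null eigenvector of D^2 h.\<close>

lemma DD_Xh_radial: assumes z: "z \<in> W" shows "DD (Nh z, 0) Xh z = 0"
proof -
  have d: "tproj z (dir z) = 0" "dir z \<bullet> dir z = 1" by (simp_all add: tproj_def dir_sphere[OF z])
  have "dirder (dir z, 0) Y z = Nh z"
    using d dirder_Y(1)[OF z, of "dir z"] linear_0[OF dirder_dir_compose(3)[OF smooth_N z]] by simp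
  note Bz = B_space[OF z this]
  show ?thesis
    unfolding DD_def Bz dirder_Xh[OF z] d(1) linear_0[OF dirder_dir_compose(3)[OF smooth_X z]] by simp
qed

text \<open>Substitute v = dN w in dN w = lam dX w. Since dX w = s D^2 h(v), the reciprocal of lam
  is s times an eigenvalue of D^2 h on the tangent plane.\<close>

lemma princ_curvs_iff:
  assumes z: "z \<in> W"
  shows "lam \<in> princ_curvs X N (dir z) (snd z) \<longleftrightarrow>
    (\<exists>v. v \<noteq> 0 \<and> v \<bullet> Nh z = 0 \<and> v = (lam * s z) *\<^sub>R DD (v, 0) Xh z)"
    (is "_ \<longleftrightarrow> ?R")
proof -
  let ?dN = "dX N (dir z) (snd z)" and ?dX = "dX X (dir z) (snd z)"
  have key: "dirder (w, 0) Y z = ?dN w" "dirder (w, 0) Xh z = ?dX w /\<^sub>R s z" if "w \<bullet> dir z = 0" for w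
    using dirder_Y(1)[OF z, of w] dirder_Xh[OF z, of w] that by (simp_all add: tproj_id)
  show ?thesis
  proof
    assume "lam \<in> princ_curvs X N (dir z) (snd z)"
    then obtain w where w: "w \<bullet> dir z = 0" "w \<noteq> 0" "?dN w = lam *\<^sub>R ?dX w"
      unfolding princ_curvs_def tangent_def by auto
    have "?dN w \<noteq> 0" using key(1)[OF w(1)] w(2) dirder_Y_inj[OF z] by metis
    moreover have "?dN w \<bullet> Nh z = 0" using key(1)[OF w(1)] dirder_Y(2)[OF z, of w] w(1) by simp
    moreover have "DD (?dN w, 0) Xh z = ?dX w /\<^sub>R s z"
      unfolding DD_def B_space[OF z key(1)[OF w(1)]] by (rule key(2)[OF w(1)])
    then have "?dN w = (lam * s z) *\<^sub>R DD (?dN w, 0) Xh z" using w(3) s_pos[OF z] by simp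
    ultimately show ?R by blast
  next
    assume ?R
    then obtain v where v': "v \<noteq> 0 \<and> v \<bullet> Nh z = 0 \<and> v = (lam * s z) *\<^sub>R DD (v, 0) Xh z" by (rule exE)
    note v = v'[THEN conjunct1] v'[THEN conjunct2, THEN conjunct1] v'[THEN conjunct2, THEN conjunct2]
    obtain w where w: "B (v, 0) z = (w, 0)" "dirder (w, 0) Y z = v" using B_space_ex[OF z] by blast
    have wd: "w \<bullet> dir z = 0" using dirder_Y(2)[OF z, of w] w v by simp
    have "w \<noteq> 0" using w v linear_0[OF linear_dirder_space[OF smooth_Y z]] by auto
    moreover have A: "DD (v, 0) Xh z = ?dX w /\<^sub>R s z"
      unfolding DD_def w(1) by (rule key(2)[OF wd])
    have "v = (lam * s z) *\<^sub>R (?dX w /\<^sub>R s z)"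
      using v(3) unfolding A .
    then have "?dN w = lam *\<^sub>R ?dX w"
      using key(1)[OF wd] w(2) s_pos[OF z] by (simp add: field_simps)
    ultimately show "lam \<in> princ_curvs X N (dir z) (snd z)"
      using wd unfolding princ_curvs_def tangent_def by auto
  qed
qed

lemma principal_frame:
  assumes z: "z \<in> W"
  obtains m1 m2 \<mu>1 \<mu>2 where "orthonormal3 m1 m2 (Nh z)"
    "DD (m1, 0) Xh z = \<mu>1 *\<^sub>R m1" "DD (m2, 0) Xh z = \<mu>2 *\<^sub>R m2" "\<mu>1 > 0" "\<mu>2 > 0"
    "princ_curvs X N (dir z) (snd z) = {1 / (s z * \<mu>1), 1 / (s z * \<mu>2)}"
proof -
  let ?A = "\<lambda>v. DD (v, 0) Xh z"
  note lin = linear_DD_Xh[OF z]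
  have "?A v \<bullet> w = v \<bullet> ?A w" for v w
    using hess_sym[OF z, of v w] unfolding hess_eq[OF z] by (simp add: inner_commute)
  from selfadjoint_eigenframe[OF lin this surface(1)[OF z] DD_Xh_radial[OF z]]
  obtain m1 m2 \<mu>1 \<mu>2 where m: "orthonormal3 m1 m2 (Nh z)" "?A m1 = \<mu>1 *\<^sub>R m1" "?A m2 = \<mu>2 *\<^sub>R m2"
    by metis
  note o = m(1)[unfolded orthonormal3_def]
  have ne: "m1 \<noteq> 0" "m2 \<noteq> 0" using o by auto
  \<comment> \<open>A vanishing eigenvalue on the tangent plane would give a nonzero tangent vector
    killed by dX, contrary to the immersion property.\<close>
  have nz: "\<mu> \<noteq> 0" if "?A v = \<mu> *\<^sub>R v" "v \<noteq> 0" "v \<bullet> Nh z = 0" for \<mu> v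
  proof
    assume "\<mu> = 0"
    obtain w where w: "B (v, 0) z = (w, 0)" "dirder (w, 0) Y z = v" using B_space_ex[OF z] by blast
    have wd: "w \<bullet> dir z = 0" using dirder_Y(2)[OF z, of w] w that by simp
    have "w \<noteq> 0" using w that linear_0[OF linear_dirder_space[OF smooth_Y z]] by auto
    moreover have "dX X (dir z) (snd z) w = 0"
      using that(1) s_pos[OF z] \<open>\<mu> = 0\<close> dirder_Xh[OF z, of w] wd unfolding DD_def w(1) by (simp add: tproj_id)
    ultimately show False using surface(4)[OF z, of w] wd by (auto simp: tangent_def)
  qed
  have mem: "1 / (s z * \<mu>) \<in> princ_curvs X N (dir z) (snd z)"
    if "?A v = \<mu> *\<^sub>R v" "v \<noteq> 0" "v \<bullet> Nh z = 0" for \<mu> v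
    unfolding princ_curvs_iff[OF z]
    using that nz[OF that] s_pos[OF z] by (intro exI[of _ v]) simp
  have mem12: "1 / (s z * \<mu>1) \<in> princ_curvs X N (dir z) (snd z)"
      "1 / (s z * \<mu>2) \<in> princ_curvs X N (dir z) (snd z)"
    using mem[OF m(2) ne(1)] mem[OF m(3) ne(2)] o by blast+
  have pos: "\<mu>1 > 0" "\<mu>2 > 0"
    using surface(3)[OF z mem12(1)] surface(3)[OF z mem12(2)] s_pos[OF z]
    by (simp_all add: zero_less_mult_iff)
  have "lam \<in> {1 / (s z * \<mu>1), 1 / (s z * \<mu>2)}" if lam: "lam \<in> princ_curvs X N (dir z) (snd z)" for lam
  proof -
    obtain v where v': "v \<noteq> 0 \<and> v \<bullet> Nh z = 0 \<and> v = (lam * s z) *\<^sub>R ?A v"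
      by (rule exE[OF lam[unfolded princ_curvs_iff[OF z]]])
    note v = v'[THEN conjunct1] v'[THEN conjunct2, THEN conjunct1] v'[THEN conjunct2, THEN conjunct2]
    have ve: "v = (v \<bullet> m1) *\<^sub>R m1 + (v \<bullet> m2) *\<^sub>R m2"
      by (rule trans[OF orthonormal3_expand[OF m(1), of v]]) (simp add: v(2))
    have "?A ((v \<bullet> m1) *\<^sub>R m1 + (v \<bullet> m2) *\<^sub>R m2) = (v \<bullet> m1) *\<^sub>R \<mu>1 *\<^sub>R m1 + (v \<bullet> m2) *\<^sub>R \<mu>2 *\<^sub>R m2"
      unfolding linear_add[OF lin] linear_cmul[OF lin] m(2,3) ..
    then have Av: "?A v = ((v \<bullet> m1) * \<mu>1) *\<^sub>R m1 + ((v \<bullet> m2) * \<mu>2) *\<^sub>R m2"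
      by (simp only: ve[symmetric] scaleR_scaleR)
    have "v \<bullet> m = (lam * s z) * (?A v \<bullet> m)" for m
      using arg_cong[OF v(3), of "\<lambda>x. x \<bullet> m"] by (simp only: inner_scaleR_left)
    from this[of m1] this[of m2]
    have "v \<bullet> m1 = lam * s z * ((v \<bullet> m1) * \<mu>1)" "v \<bullet> m2 = lam * s z * ((v \<bullet> m2) * \<mu>2)"
      unfolding Av using o by (simp_all add: inner_add_left inner_add_right inner_commute)
    moreover have "v \<bullet> m1 \<noteq> 0 \<or> v \<bullet> m2 \<noteq> 0" using ve v(1) by (metis add_0 scale_zero_left)
    \<comment> \<open>A nonzero component of v along either eigenvector can be cancelled, which
      fixes lam; this includes the umbilic case of equal eigenvalues.\<close>
    ultimately have "lam * s z * \<mu>1 = 1 \<or> lam * s z * \<mu>2 = 1" by auto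
    then show ?thesis using pos s_pos[OF z] by (auto simp: field_simps)
  qed
  then have "princ_curvs X N (dir z) (snd z) = {1 / (s z * \<mu>1), 1 / (s z * \<mu>2)}"
    using mem12 by blast
  then show ?thesis using that m pos by blast
qed

section \<open>Gap and speed as polynomials in s and the Hessian entries\<close>

definition htrace :: "real^3 \<Rightarrow> real^3 \<Rightarrow> real^3 \<Rightarrow> (real^3) \<times> real \<Rightarrow> real" where
  "htrace e1 e2 e3 z = hess e1 e1 z + hess e2 e2 z + hess e3 e3 z"
definition hnorm :: "real^3 \<Rightarrow> real^3 \<Rightarrow> real^3 \<Rightarrow> (real^3) \<times> real \<Rightarrow> real" where
  "hnorm e1 e2 e3 z = hess e1 e1 z * hess e1 e1 z + hess e2 e2 z * hess e2 e2 z + hess e3 e3 z * hess e3 e3 z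
     + 2 * (hess e1 e2 z * hess e1 e2 z + hess e1 e3 z * hess e1 e3 z + hess e2 e3 z * hess e2 e3 z)"

text \<open>\<open>lam1\<close> and \<open>lam2\<close> come from Max and Min and may fail to be
  smooth at umbilics. The trace and the squared norm of D^2 h in a constant orthonormal frame are
  smooth, and by frame invariance they are the sum and the sum of squares of the eigenvalues, the
  third being 0.\<close>

lemma gap_speed_formulas:
  assumes z: "z \<in> W" and e: "orthonormal3 e1 e2 e3"
  shows "gap z = (s z * s z) * (hnorm e1 e2 e3 z / 2 - htrace e1 e2 e3 z * htrace e1 e2 e3 z / 4)"
    and "speed z = (s z * (s z * s z)) * ((htrace e1 e2 e3 z * htrace e1 e2 e3 z - hnorm e1 e2 e3 z) / 2)"
proof -
  obtain m1 m2 \<mu>1 \<mu>2 where m: "orthonormal3 m1 m2 (Nh z)"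
    "DD (m1, 0) Xh z = \<mu>1 *\<^sub>R m1" "DD (m2, 0) Xh z = \<mu>2 *\<^sub>R m2" "\<mu>1 > 0" "\<mu>2 > 0"
    "princ_curvs X N (dir z) (snd z) = {1 / (s z * \<mu>1), 1 / (s z * \<mu>2)}"
    using principal_frame[OF z] by metis
  let ?A = "\<lambda>v. DD (v, 0) Xh z"
  note lin = linear_DD_Xh[OF z] and o = m(1)[unfolded orthonormal3_def]
  have A: "?A v = ((v \<bullet> m1) * \<mu>1) *\<^sub>R m1 + ((v \<bullet> m2) * \<mu>2) *\<^sub>R m2" for v
  proof -
    have "?A ((v \<bullet> m1) *\<^sub>R m1 + (v \<bullet> m2) *\<^sub>R m2 + (v \<bullet> Nh z) *\<^sub>R Nh z)
        = (v \<bullet> m1) *\<^sub>R \<mu>1 *\<^sub>R m1 + (v \<bullet> m2) *\<^sub>R \<mu>2 *\<^sub>R m2"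
      unfolding linear_add[OF lin] linear_cmul[OF lin] m(2,3) DD_Xh_radial[OF z] by simp
    then show ?thesis by (simp only: orthonormal3_expand[OF m(1), of v, symmetric] scaleR_scaleR)
  qed
  have AA: "?A v \<bullet> ?A v = (v \<bullet> m1)\<^sup>2 * \<mu>1\<^sup>2 + (v \<bullet> m2)\<^sup>2 * \<mu>2\<^sup>2" for v
    unfolding A using o by (simp add: inner_add_left inner_add_right inner_commute power2_eq_square)
  have Av: "?A v \<bullet> v = (v \<bullet> m1)\<^sup>2 * \<mu>1 + (v \<bullet> m2)\<^sup>2 * \<mu>2" for v
    unfolding A by (simp add: inner_add_left inner_add_right inner_commute[of m1] inner_commute[of m2] power2_eq_square)
  \<comment> \<open>Parseval in the frame e1, e2, e3 carries the frame invariance of both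
    quantities.\<close>
  have pars: "(e1 \<bullet> v)\<^sup>2 + (e2 \<bullet> v)\<^sup>2 + (e3 \<bullet> v)\<^sup>2 = v \<bullet> v" for v
    using orthonormal3_inner[OF e, of v v] by (simp add: inner_commute power2_eq_square)
  have "htrace e1 e2 e3 z = ((e1 \<bullet> m1)\<^sup>2 + (e2 \<bullet> m1)\<^sup>2 + (e3 \<bullet> m1)\<^sup>2) * \<mu>1
      + ((e1 \<bullet> m2)\<^sup>2 + (e2 \<bullet> m2)\<^sup>2 + (e3 \<bullet> m2)\<^sup>2) * \<mu>2"
    unfolding htrace_def hess_eq[OF z] Av by algebra
  then have T: "htrace e1 e2 e3 z = \<mu>1 + \<mu>2" unfolding pars using o by simp
  have row: "?A v \<bullet> ?A v = hess v e1 z * hess v e1 z + hess v e2 z * hess v e2 z + hess v e3 z * hess v e3 z" for v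
    unfolding hess_eq[OF z] by (rule orthonormal3_inner[OF e])
  have "hnorm e1 e2 e3 z = ?A e1 \<bullet> ?A e1 + ?A e2 \<bullet> ?A e2 + ?A e3 \<bullet> ?A e3"
    unfolding hnorm_def row using hess_sym[OF z, of e2 e1] hess_sym[OF z, of e3 e1] hess_sym[OF z, of e3 e2] by simp
  also have "\<dots> = ((e1 \<bullet> m1)\<^sup>2 + (e2 \<bullet> m1)\<^sup>2 + (e3 \<bullet> m1)\<^sup>2) * \<mu>1\<^sup>2
      + ((e1 \<bullet> m2)\<^sup>2 + (e2 \<bullet> m2)\<^sup>2 + (e3 \<bullet> m2)\<^sup>2) * \<mu>2\<^sup>2"
    unfolding AA by algebra
  finally have Q: "hnorm e1 e2 e3 z = \<mu>1\<^sup>2 + \<mu>2\<^sup>2" unfolding pars using o by simp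
  define \<sigma> where "\<sigma> = s z"
  have \<sigma>: "\<sigma> > 0" using s_pos[OF z] by (simp add: \<sigma>_def)
  have mm: "lam1 X N (dir z) (snd z) = max (1 / (\<sigma> * \<mu>1)) (1 / (\<sigma> * \<mu>2))"
    "lam2 X N (dir z) (snd z) = min (1 / (\<sigma> * \<mu>1)) (1 / (\<sigma> * \<mu>2))"
    unfolding lam1_def lam2_def m(6) \<sigma>_def by simp_all
  \<comment> \<open>Product and squared difference are symmetric, so it does not matter which
    eigenvalue yields the maximum.\<close>
  have l: "lam1 X N (dir z) (snd z) * lam2 X N (dir z) (snd z) = 1 / (\<sigma> * \<mu>1) * (1 / (\<sigma> * \<mu>2))"
    "(lam1 X N (dir z) (snd z) - lam2 X N (dir z) (snd z))\<^sup>2 = (1 / (\<sigma> * \<mu>1) - 1 / (\<sigma> * \<mu>2))\<^sup>2"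
    unfolding mm by (simp_all add: max_def min_def mult.commute power2_commute)
  have "gap z = (1 / (\<sigma> * \<mu>1) - 1 / (\<sigma> * \<mu>2))\<^sup>2 / (4 * (1 / (\<sigma> * \<mu>1) * (1 / (\<sigma> * \<mu>2)))\<^sup>2)"
    unfolding gap_def Let_def l[symmetric] power_mult_distrib by (simp add: mult.assoc)
  also have "\<dots> = \<sigma> * \<sigma> * ((\<mu>1\<^sup>2 + \<mu>2\<^sup>2) / 2 - (\<mu>1 + \<mu>2) * (\<mu>1 + \<mu>2) / 4)"
    using \<sigma> m(4,5) by (simp add: field_simps power2_eq_square)
  finally show "gap z = (s z * s z) * (hnorm e1 e2 e3 z / 2 - htrace e1 e2 e3 z * htrace e1 e2 e3 z / 4)"
    unfolding T Q \<sigma>_def .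
  have "speed z = \<sigma> / (1 / (\<sigma> * \<mu>1) * (1 / (\<sigma> * \<mu>2)))"
    unfolding speed_eq[OF z] gaussK_def l \<sigma>_def ..
  also have "\<dots> = \<sigma> * (\<sigma> * \<sigma>) * (((\<mu>1 + \<mu>2) * (\<mu>1 + \<mu>2) - (\<mu>1\<^sup>2 + \<mu>2\<^sup>2)) / 2)"
    using \<sigma> m(4,5) by (simp add: field_simps power2_eq_square)
  finally show "speed z = (s z * (s z * s z)) * ((htrace e1 e2 e3 z * htrace e1 e2 e3 z - hnorm e1 e2 e3 z) / 2)"
    unfolding T Q \<sigma>_def .
qed

text \<open>Euler's relation for the 0-homogeneous gradient X. It is written with constant frame
  vectors, not the moving normal, so that it can be differentiated.\<close>

lemma hess_Euler:
  assumes z: "z \<in> W" and e: "orthonormal3 e1 e2 e3"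
  shows "(Y z \<bullet> e1) * hess e1 w z + (Y z \<bullet> e2) * hess e2 w z + (Y z \<bullet> e3) * hess e3 w z = 0"
proof -
  note lin = linear_DD_Xh[OF z]
  have "DD (Y z, 0) Xh z = 0"
    unfolding Y_def linear_cmul[OF lin] DD_Xh_radial[OF z] by simp
  moreover have "DD (Y z, 0) Xh z = DD ((Y z \<bullet> e1) *\<^sub>R e1 + (Y z \<bullet> e2) *\<^sub>R e2 + (Y z \<bullet> e3) *\<^sub>R e3, 0) Xh z"
    by (simp only: orthonormal3_expand[OF e, of "Y z", symmetric])
  ultimately have "((Y z \<bullet> e1) *\<^sub>R DD (e1, 0) Xh z + (Y z \<bullet> e2) *\<^sub>R DD (e2, 0) Xh z
      + (Y z \<bullet> e3) *\<^sub>R DD (e3, 0) Xh z) \<bullet> w = 0"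
    unfolding linear_add[OF lin] linear_cmul[OF lin] by simp
  then show ?thesis unfolding hess_eq[OF z] by (simp add: inner_add_left)
qed

text \<open>Commuting the time field past both space fields turns the evolution of D^2 h into the
  Hessian of the speed.\<close>

lemma DD_hess: assumes z: "z \<in> W" shows "DD (0, 1) (hess v w) z = DD (v, 0) (DD (w, 0) speed) z"
proof -
  have "DD (0, 1) (hess v w) z = DD (v, 0) (DD (0, 1) (DD (w, 0) H)) z"
    unfolding hess_def by (rule DD_commute[OF smooth_on_DD[OF smooth_H] z])
  also have "\<dots> = DD (v, 0) (DD (w, 0) (DD (0, 1) H)) z"
    by (rule DD_cong[OF z]) (rule DD_commute[OF smooth_H])
  finally show ?thesis unfolding speed_def .
qed

lemma DD_hess_sym: "z \<in> W \<Longrightarrow> DD V (hess v w) z = DD V (hess w v) z"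
  by (rule DD_cong) (auto intro: hess_sym)

text \<open>Together with the symmetry of \<open>hess\<close> this makes third derivatives of h
  totally symmetric, the counterpart of the Codazzi equations.\<close>

lemma DD_hess_swap: "z \<in> W \<Longrightarrow> DD (u, 0) (hess v w) z = DD (v, 0) (hess u w) z"
  unfolding hess_def by (rule DD_commute[OF smooth_on_DD[OF smooth_H]])

section \<open>Second-order expansions of gap and speed in an eigenframe\<close>

lemma jet_inner_Y: "z \<in> W \<Longrightarrow> jet z V (\<lambda>z. Y z \<bullet> e) (Y z \<bullet> e) (fst V \<bullet> e) 0"
proof -
  assume z: "z \<in> W"
  have 1: "DD V (\<lambda>z. Y z \<bullet> e) y = fst V \<bullet> e" if "y \<in> W" for y
    by (simp add: DD_inner_const[OF smooth_Y that] DD_Y[OF that])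
  have "DD V (DD V (\<lambda>z. Y z \<bullet> e)) z = DD V (\<lambda>z. fst V \<bullet> e) z"
    by (rule DD_cong[OF z]) (rule 1)
  then show ?thesis
    using z 1 by (simp add: jet_def DD_const smooth_on_bounded_linear[OF bounded_linear_inner_left smooth_Y])
qed

text \<open>Expand s^2 = |Y|^2 to second order: with s = 1 and V orthogonal to Y the first
  derivative of s vanishes, and 2 s'' = 2 |V|^2. For the time field this gives s'' = 0.\<close>

lemma jet_s:
  assumes z: "z \<in> W" and s1: "s z = 1" and V: "fst V \<bullet> Y z = 0"
  shows "jet z V s 1 0 (fst V \<bullet> fst V)"
proof -
  have 1: "DD V (\<lambda>z. Y z \<bullet> Y z) y = 2 * (Y y \<bullet> fst V)" if "y \<in> W" for y
    by (simp add: DD_inner[OF smooth_Y smooth_Y that] DD_Y[OF that] inner_commute)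
  have "DD V (DD V (\<lambda>z. Y z \<bullet> Y z)) z = DD V (\<lambda>z. 2 * (Y z \<bullet> fst V)) z"
    by (rule DD_cong[OF z]) (rule 1)
  also have "\<dots> = 2 * (fst V \<bullet> fst V)"
    using jet_mult[OF jet_const[OF z, of V 2] jet_inner_Y[OF z, of V "fst V"]] by (simp add: jet_def)
  finally have "jet z V (\<lambda>z. Y z \<bullet> Y z) 1 0 (2 * (fst V \<bullet> fst V))"
    using 1[OF z] V z s1 Y_inner[OF z] by (simp add: jet_def smooth_on_inner smooth_Y inner_commute)
  then have "jet z V (\<lambda>z. s z * s z) 1 0 (2 * (fst V \<bullet> fst V))"
    by (rule jet_cong) (simp add: Y_inner)
  moreover note jet_mult[OF jetI[OF z smooth_s, of V] jetI[OF z smooth_s, of V]]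
  ultimately show ?thesis
    using z s1 smooth_s unfolding jet_def by auto
qed

text \<open>Jet arithmetic on the polynomial formulas, at a point where the frame diagonalises D^2 h
  with eigenvalues p, q, 0. The letters o, x, y belong to the off-diagonal entries 12, 13, 23; these
  vanish at z, so they contribute only squares of first derivatives.\<close>

lemma jet_gap_speed:
  assumes e: "orthonormal3 e1 e2 e3" and js: "jet z V s 1 0 \<sigma>"
    and h11: "jet z V (hess e1 e1) p p1 p2" and h22: "jet z V (hess e2 e2) q q1 q2" and h33: "jet z V (hess e3 e3) 0 0 r2"
    and h12: "jet z V (hess e1 e2) 0 o1 o2" and h13: "jet z V (hess e1 e3) 0 x1 x2" and h23: "jet z V (hess e2 e3) 0 y1 y2"
  shows "jet z V gap ((p - q)\<^sup>2 / 4) ((p - q) * (p1 - q1) / 2)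
      (2 * \<sigma> * ((p - q)\<^sup>2 / 4) + ((p1\<^sup>2 + p * p2) + (q1\<^sup>2 + q * q2) + 2 * (o1\<^sup>2 + x1\<^sup>2 + y1\<^sup>2))
        - ((p1 + q1)\<^sup>2 + (p + q) * (p2 + q2 + r2)) / 2)"
    and "DD V (DD V speed) z = 3 * \<sigma> * (p * q) + ((p1 + q1)\<^sup>2 + (p + q) * (p2 + q2 + r2))
        - ((p1\<^sup>2 + p * p2) + (q1\<^sup>2 + q * q2) + 2 * (o1\<^sup>2 + x1\<^sup>2 + y1\<^sup>2))"
proof -
  have z: "z \<in> W" using js by (simp add: jet_def)
  note jT = jet_add[OF jet_add[OF h11 h22] h33]
  note jN = jet_add[OF jet_add[OF jet_add[OF jet_mult[OF h11 h11] jet_mult[OF h22 h22]] jet_mult[OF h33 h33]]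
    jet_mult[OF jet_const[OF z, of V 2] jet_add[OF jet_add[OF jet_mult[OF h12 h12] jet_mult[OF h13 h13]] jet_mult[OF h23 h23]]]]
  note jss = jet_mult[OF js js]
  note jG = jet_mult[OF jss jet_add[OF jet_mult[OF jN jet_const[OF z, of V "1/2"]]
      jet_mult[OF jet_mult[OF jT jT] jet_const[OF z, of V "-1/4"]]]]
  note jS = jet_mult[OF jet_mult[OF js jss] jet_add[OF jet_mult[OF jN jet_const[OF z, of V "-1/2"]]
      jet_mult[OF jet_mult[OF jT jT] jet_const[OF z, of V "1/2"]]]]
  \<comment> \<open>Division is rewritten as multiplication by constants, to match the sums and
    products of \<open>jG\<close> term by term.\<close>
  have eqG: "gap y = (s y * s y) * ((hess e1 e1 y * hess e1 e1 y + hess e2 e2 y * hess e2 e2 y + hess e3 e3 y * hess e3 e3 y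
     + 2 * (hess e1 e2 y * hess e1 e2 y + hess e1 e3 y * hess e1 e3 y + hess e2 e3 y * hess e2 e3 y)) * (1 / 2)
     + (hess e1 e1 y + hess e2 e2 y + hess e3 e3 y) * (hess e1 e1 y + hess e2 e2 y + hess e3 e3 y) * (- 1 / 4))" if "y \<in> W" for y
    unfolding gap_speed_formulas(1)[OF that e] hnorm_def htrace_def by (simp add: field_simps)
  have eqS: "speed y = (s y * (s y * s y)) * ((hess e1 e1 y * hess e1 e1 y + hess e2 e2 y * hess e2 e2 y + hess e3 e3 y * hess e3 e3 y
     + 2 * (hess e1 e2 y * hess e1 e2 y + hess e1 e3 y * hess e1 e3 y + hess e2 e3 y * hess e2 e3 y)) * (- 1 / 2)
     + (hess e1 e1 y + hess e2 e2 y + hess e3 e3 y) * (hess e1 e1 y + hess e2 e2 y + hess e3 e3 y) * (1 / 2))" if "y \<in> W" for y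
    unfolding gap_speed_formulas(2)[OF that e] hnorm_def htrace_def by (simp add: field_simps)
  show "jet z V gap ((p - q)\<^sup>2 / 4) ((p - q) * (p1 - q1) / 2)
      (2 * \<sigma> * ((p - q)\<^sup>2 / 4) + ((p1\<^sup>2 + p * p2) + (q1\<^sup>2 + q * q2) + 2 * (o1\<^sup>2 + x1\<^sup>2 + y1\<^sup>2))
        - ((p1 + q1)\<^sup>2 + (p + q) * (p2 + q2 + r2)) / 2)"
    by (rule jet_eqI[OF jet_cong[OF jG eqG]]) (simp_all add: field_simps power2_eq_square)
  from jet_cong[OF jS eqS]
  show "DD V (DD V speed) z = 3 * \<sigma> * (p * q) + ((p1 + q1)\<^sup>2 + (p + q) * (p2 + q2 + r2))
        - ((p1\<^sup>2 + p * p2) + (q1\<^sup>2 + q * q2) + 2 * (o1\<^sup>2 + x1\<^sup>2 + y1\<^sup>2))"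
    unfolding jet_def by (simp add: field_simps power2_eq_square)
qed

text \<open>The first and second derivatives of the Euler relation express every derivative with a
  normal slot through lower-order ones. These are the terms contributed by the curvature of the
  sphere.\<close>

lemma hess_Euler_derivs:
  assumes z: "z \<in> W" and e: "orthonormal3 e1 e2 e3" and Y: "Y z = e3"
  shows "DD V (hess e3 w) z + (fst V \<bullet> e1) * hess e1 w z + (fst V \<bullet> e2) * hess e2 w z + (fst V \<bullet> e3) * hess e3 w z = 0"
    and "DD V (DD V (hess e3 w)) z + 2 * (fst V \<bullet> e1) * DD V (hess e1 w) z
      + 2 * (fst V \<bullet> e2) * DD V (hess e2 w) z + 2 * (fst V \<bullet> e3) * DD V (hess e3 w) z = 0"
proof -
  note j = jet_mult[OF jet_inner_Y[OF z] jetI[OF z smooth_hess]]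
  have "jet z V (\<lambda>z. 0) 0 0 0" by (rule jet_const[OF z])
  then have j0: "jet z V (\<lambda>z. (Y z \<bullet> e1) * hess e1 w z + (Y z \<bullet> e2) * hess e2 w z + (Y z \<bullet> e3) * hess e3 w z) 0 0 0"
    by (rule jet_cong) (rule hess_Euler[OF _ e])
  note o = e[unfolded orthonormal3_def]
  have Ye: "Y z \<bullet> e1 = 0" "Y z \<bullet> e2 = 0" "Y z \<bullet> e3 = 1" using o by (simp_all add: Y inner_commute)
  note c = jet_add[OF jet_add[OF j j] j, of V e1 e1 w e2 e2 w e3 e3 w, unfolded Ye] 
  have h0: "hess e3 w z = 0" using hess_Euler[OF z e, of w] by (simp add: Ye)
  have "fst V \<bullet> e1 * hess e1 w z + fst V \<bullet> e2 * hess e2 w z + DD V (hess e3 w) z = 0"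
    "2 * (fst V \<bullet> e1) * DD V (hess e1 w) z + 2 * (fst V \<bullet> e2) * DD V (hess e2 w) z
      + (DD V (DD V (hess e3 w)) z + 2 * (fst V \<bullet> e3) * DD V (hess e3 w) z) = 0"
    using c j0 unfolding jet_def by (simp_all add: h0)
  then show "DD V (hess e3 w) z + (fst V \<bullet> e1) * hess e1 w z + (fst V \<bullet> e2) * hess e2 w z + (fst V \<bullet> e3) * hess e3 w z = 0"
    "DD V (DD V (hess e3 w)) z + 2 * (fst V \<bullet> e1) * DD V (hess e1 w) z
      + 2 * (fst V \<bullet> e2) * DD V (hess e2 w) z + 2 * (fst V \<bullet> e3) * DD V (hess e3 w) z = 0"
    unfolding h0 by linarith+
qed

text \<open>In the eigenframe the time derivative of the gap is (p - q)/2 times the difference of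
  the second derivatives of the speed. All jets reduce to a1, a2, b1, b2, F1, F2, F3, which leaves
  the inequality of \<open>gap_decrease\<close>.\<close>

lemma DD_gap_nonpos:
  assumes z: "z \<in> W" and s1: "s z = 1"
    and crit: "\<And>v. DD (v, 0) gap z = 0" and neg: "\<And>v. DD (v, 0) (DD (v, 0) gap) z \<le> 0"
  shows "DD (0, 1) gap z \<le> 0"
proof -
  obtain m1 m2 p q where m: "orthonormal3 m1 m2 (Nh z)"
    "DD (m1, 0) Xh z = p *\<^sub>R m1" "DD (m2, 0) Xh z = q *\<^sub>R m2" "p > 0" "q > 0"
    using principal_frame[OF z] by metis
  define n where "n = Nh z"
  have e: "orthonormal3 m1 m2 n" and Y: "Y z = n" using m(1) s1 by (simp_all add: n_def Y_def)
  note o = e[unfolded orthonormal3_def]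
  have o': "m1 \<bullet> m1 = 1" "m2 \<bullet> m2 = 1" "n \<bullet> n = 1" "m1 \<bullet> m2 = 0" "m2 \<bullet> m1 = 0"
    "m1 \<bullet> n = 0" "n \<bullet> m1 = 0" "m2 \<bullet> n = 0" "n \<bullet> m2 = 0" using o by (simp_all add: inner_commute)
  have hv: "hess m1 m1 z = p" "hess m2 m2 z = q" "hess m1 m2 z = 0" "hess m1 n z = 0" "hess m2 n z = 0" "hess n n z = 0"
    "hess n m1 z = 0" "hess n m2 z = 0" "hess m2 m1 z = 0"
    using o' by (simp_all add: hess_eq[OF z] m DD_Xh_radial[OF z, folded n_def])
  note E = hess_Euler_derivs[OF z e Y] and sw = DD_hess_swap[OF z] and sy = DD_hess_sym[OF z]
  define a1 where "a1 = DD (m1, 0) (hess m1 m1) z"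
  define b1 where "b1 = DD (m2, 0) (hess m1 m1) z"
  define a2 where "a2 = DD (m1, 0) (hess m2 m2) z"
  define b2 where "b2 = DD (m2, 0) (hess m2 m2) z"
  define F1 where "F1 = DD (m1, 0) (DD (m1, 0) (hess m1 m1)) z"
  define F2 where "F2 = DD (m1, 0) (DD (m1, 0) (hess m2 m2)) z"
  define F3 where "F3 = DD (m2, 0) (DD (m2, 0) (hess m2 m2)) z"
  have h12: "DD (m1, 0) (hess m1 m2) z = b1" "DD (m2, 0) (hess m1 m2) z = a2"
    using sw[of m1 m2 m1] sw[of m2 m1 m2] sy[of "(m1, 0)" m1 m2] by (simp_all add: a2_def b1_def)
  \<comment> \<open>Both mixed fourth derivatives are h_1122; without this identification they would
    not cancel.\<close>
  have F2': "DD (m2, 0) (DD (m2, 0) (hess m1 m1)) z = F2"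
  proof -
    have "DD (m2, 0) (DD (m2, 0) (hess m1 m1)) z = DD (m2, 0) (DD (m1, 0) (hess m2 m1)) z"
      by (rule DD_cong[OF z]) (rule DD_hess_swap)
    also have "\<dots> = DD (m1, 0) (DD (m2, 0) (hess m2 m1)) z"
      by (rule DD_commute[OF smooth_hess z])
    also have "\<dots> = DD (m1, 0) (DD (m2, 0) (hess m1 m2)) z"
      by (rule DD_cong[OF z]) (rule DD_hess_sym)
    also have "\<dots> = F2"
      unfolding F2_def by (rule DD_cong[OF z]) (rule DD_hess_swap)
    finally show ?thesis .
  qed
  \<comment> \<open>The once differentiated Euler relation gives h_11n = -p, and the twice
    differentiated one gives h_nn11 = -2 h_11n = 2 p.\<close>
  have n1: "DD (m1, 0) (hess m1 n) z = - p" "DD (m1, 0) (hess m2 n) z = 0" "DD (m1, 0) (hess n n) z = 0"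
    "DD (m1, 0) (DD (m1, 0) (hess n n)) z = 2 * p"
    using E[of "(m1, 0)" m1] E[of "(m1, 0)" m2] E[of "(m1, 0)" n] sy[of "(m1, 0)" m1 n] sy[of "(m1, 0)" m2 n]
    by (simp_all add: hv o')
  have n2: "DD (m2, 0) (hess m1 n) z = 0" "DD (m2, 0) (hess m2 n) z = - q" "DD (m2, 0) (hess n n) z = 0"
    "DD (m2, 0) (DD (m2, 0) (hess n n)) z = 2 * q"
    using E[of "(m2, 0)" m1] E[of "(m2, 0)" m2] E[of "(m2, 0)" n] sy[of "(m2, 0)" m1 n] sy[of "(m2, 0)" m2 n]
    by (simp_all add: hv o')
  have nt: "DD (0, 1) (hess n n) z = 0" using E(1)[of "(0, 1)" n] by (simp add: hv)
  have J: "jet z V (hess v w) c0 c1 c2" if "hess v w z = c0" "DD V (hess v w) z = c1" "DD V (DD V (hess v w)) z = c2" for V v w c0 c1 c2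
    using that z smooth_hess by (simp add: jet_def)
  have js: "jet z (m1, 0) s 1 0 1" "jet z (m2, 0) s 1 0 1" "jet z (0, 1) s 1 0 0"
    using jet_s[OF z s1, of "(m1, 0)"] jet_s[OF z s1, of "(m2, 0)"] jet_s[OF z s1, of "(0, 1)"] o' by (simp_all add: Y)
  note j1 = jet_gap_speed[OF e js(1) J[OF hv(1) a1_def[symmetric] F1_def[symmetric]]
      J[OF hv(2) a2_def[symmetric] F2_def[symmetric]] J[OF hv(6) n1(3,4)] J[OF hv(3) h12(1) refl]
      J[OF hv(4) n1(1) refl] J[OF hv(5) n1(2) refl]]
  note j2 = jet_gap_speed[OF e js(2) J[OF hv(1) b1_def[symmetric] F2']
      J[OF hv(2) b2_def[symmetric] F3_def[symmetric]] J[OF hv(6) n2(3,4)] J[OF hv(3) h12(2) refl]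
      J[OF hv(4) n2(1) refl] J[OF hv(5) n2(2) refl]]
  \<comment> \<open>Along the time field only the first-order entry of the jet is used; the diagonal
    Hessian entries change by second derivatives of the speed.\<close>
  note jt = jet_gap_speed(1)[OF e js(3) J[OF hv(1) DD_hess[OF z] refl] J[OF hv(2) DD_hess[OF z] refl]
      J[OF hv(6) nt refl] J[OF hv(3) refl refl] J[OF hv(4) refl refl] J[OF hv(5) refl refl]]
  have "(p - q) * (DD (m1, 0) (DD (m1, 0) speed) z - DD (m2, 0) (DD (m2, 0) speed) z) / 2 \<le> 0"
  proof (rule gap_decrease[OF m(4,5)])
    show "(p - q) * (a1 - a2) / 2 = 0" using j1(1) crit unfolding jet_def by metis
    show "(p - q) * (b1 - b2) / 2 = 0" using j2(1) crit unfolding jet_def by metis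
    show "2 * ((p - q)\<^sup>2 / 4) + ((a1\<^sup>2 + p * F1) + (a2\<^sup>2 + q * F2) + 2 * (b1\<^sup>2 + p\<^sup>2))
          - ((a1 + a2)\<^sup>2 + (p + q) * (F1 + F2 + 2 * p)) / 2 \<le> 0"
      using j1(1) neg[of m1] unfolding jet_def by simp
    show "2 * ((p - q)\<^sup>2 / 4) + ((b1\<^sup>2 + p * F2) + (b2\<^sup>2 + q * F3) + 2 * (a2\<^sup>2 + q\<^sup>2))
          - ((b1 + b2)\<^sup>2 + (p + q) * (F2 + F3 + 2 * q)) / 2 \<le> 0"
      using j2(1) neg[of m2] unfolding jet_def by simp
  qed (use j1(2) j2(2) in simp_all)
  moreover have "DD (0, 1) gap z = (p - q) * (DD (m1, 0) (DD (m1, 0) speed) z - DD (m2, 0) (DD (m2, 0) speed) z) / 2"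
    using jt unfolding jet_def by blast
  ultimately show ?thesis by simp
qed

section \<open>Maximum principle in space and time\<close>

lemma smooth_gap: "smooth_on W gap"
proof (rule smooth_on_cong)
  let ?e = "\<lambda>i::3. axis i (1::real)"
  have e: "orthonormal3 (?e 1) (?e 2) (?e 3)"
    by (simp add: orthonormal3_def inner_axis_axis)
  \<comment> \<open>The standard frame serves at all points at once, so smoothness is read off a
    polynomial and umbilics cause no trouble.\<close>
  show "smooth_on W (\<lambda>z. (s z * s z) * (hnorm (?e 1) (?e 2) (?e 3) z * (1/2)
      - htrace (?e 1) (?e 2) (?e 3) z * htrace (?e 1) (?e 2) (?e 3) z * (1/4)))"
    unfolding hnorm_def htrace_def
    by (intro smooth_on_mult smooth_on_diff smooth_on_add smooth_on_const open_W smooth_s smooth_hess)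
  show "(s z * s z) * (hnorm (?e 1) (?e 2) (?e 3) z * (1/2)
      - htrace (?e 1) (?e 2) (?e 3) z * htrace (?e 1) (?e 2) (?e 3) z * (1/4)) = gap z" if "z \<in> W" for z
    unfolding gap_speed_formulas(1)[OF that e] by simp
qed

text \<open>The gap is 0-homogeneous, so a maximum over the sphere is one over all x different from
  0. In this open set the derivative tests along straight lines carry no constraint.\<close>

lemma gap_spatial_max:
  assumes t: "t \<in> {a<..<b}" and u: "u \<in> S2" and max: "\<And>x. x \<in> S2 \<Longrightarrow> gap (x, t) \<le> gap (u, t)"
  shows "DD (0, 1) gap (u, t) \<le> 0" "dirder (w, 0) gap (u, t) = 0"
proof -
  let ?z = "(u, t)"
  have z: "?z \<in> W" using t u by (auto simp: W_def)
  have max': "gap (x, t) \<le> gap (u, t)" if "x \<noteq> 0" for x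
  proof -
    have "(x, t) \<in> W" using that t by (auto simp: W_def)
    then have d: "dir (x, t) \<in> S2" by (rule dir_sphere)
    have "dir (dir (x, t), t) = dir (x, t)" using d by (simp add: dir_def[of "(dir (x, t), t)"] s_def)
    then have "gap (x, t) = gap (dir (x, t), t)" by (simp add: gap_def)
    then show ?thesis using max[OF d] by simp
  qed
  have test: "dirder (w, 0) gap ?z = 0" "dirder (w, 0) (dirder (w, 0) gap) ?z \<le> 0" for w
  proof -
    obtain r where r: "r > 0" "ball ?z r \<subseteq> W" using open_W z open_contains_ball by blast
    define d where "d = r / (norm w + 1)"
    have "norm w + 1 > 0" using norm_ge_zero[of w] by linarith
    then have d: "d > 0" unfolding d_def using r by simp
    have inW: "?z + h *\<^sub>R (w, 0) \<in> W" if "\<bar>h\<bar> < d" for h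
    proof -
      have "\<bar>h\<bar> * norm w \<le> \<bar>h\<bar> * (norm w + 1)" by (simp add: mult_left_mono)
      also have "\<dots> < r" using that \<open>norm w + 1 > 0\<close> unfolding d_def by (simp add: pos_less_divide_eq)
      finally have "dist ?z (?z + h *\<^sub>R (w, 0)) < r" by (simp add: dist_norm norm_Pair)
      then show ?thesis using r(2) by (auto simp: subset_iff)
    qed
    let ?\<phi> = "\<lambda>h. gap (?z + h *\<^sub>R (w, 0))" and ?\<phi>' = "\<lambda>h. dirder (w, 0) gap (?z + h *\<^sub>R (w, 0))"
    have 1: "(?\<phi> has_real_derivative ?\<phi>' h) (at h)" if "\<bar>h\<bar> < d" for h
      by (rule dirder_line[OF smooth_gap inW[OF that]])
    have "\<bar>0::real\<bar> < d" using d by simp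
    from dirder_line[OF smooth_on_dirder[OF smooth_gap] inW[OF this]]
    have 2: "(?\<phi>' has_real_derivative dirder (w, 0) (dirder (w, 0) gap) (?z + 0 *\<^sub>R (w, 0))) (at 0)" .
    have 3: "?\<phi> h \<le> ?\<phi> 0" if "\<bar>h\<bar> < d" for h
      using inW[OF that] max'[of "u + h *\<^sub>R w"] by (simp add: W_def)
    show "dirder (w, 0) gap ?z = 0" "dirder (w, 0) (dirder (w, 0) gap) ?z \<le> 0"
      using second_derivative_local_max[OF d 1 2 3] by simp_all
  qed
  show "dirder (w, 0) gap (u, t) = 0" by (rule test)
  show "DD (0, 1) gap ?z \<le> 0"
  proof (rule DD_gap_nonpos[OF z])
    show "s ?z = 1" using u by (simp add: s_def)
    fix v
    obtain w where w: "B (v, 0) ?z = (w, 0)" using B_space_ex[OF z] by blast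
    show "DD (v, 0) gap ?z = 0" unfolding DD_def w by (rule test)
    \<comment> \<open>Differentiating twice along \<open>B (v, 0)\<close> adds to the second
      derivative on a line a first derivative along the change of the field. That change has no time
      component, so the extra term vanishes at the critical point.\<close>
    have "dirder V (\<lambda>z. snd (B (v, 0) z)) ?z = 0" for V
      by (simp add: B_def dirder_const)
    then have "snd (dirder V (B (v, 0)) ?z) = 0" for V
      using dirder_bounded_linear[OF bounded_linear_snd smooth_B[of "(v, 0)"] z, of V] by simp
    then have "dirder (dirder (B (v, 0) ?z) (B (v, 0)) ?z) gap ?z = 0"
      using test(1)[of "fst (dirder (B (v, 0) ?z) (B (v, 0)) ?z)"] by (metis prod.collapse)
    then show "DD (v, 0) (DD (v, 0) gap) ?z \<le> 0"
      using test(2)[of w] dirder_dirder_field[OF smooth_B[of "(v, 0)"] smooth_gap z, of "B (v, 0) ?z"]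
      unfolding DD_def w by simp
  qed
qed

text \<open>At such a point the time derivative of gap - \<epsilon> t is at most -\<epsilon>, so
  slightly earlier values would be larger. Looking only backwards allows t0 to be the final time of
  the slab.\<close>

lemma gap_interior_max:
  assumes t: "t0 \<in> {a<..<b}" "t1 \<in> {a<..<b}" "t1 < t0" and u: "u \<in> S2" and \<epsilon>: "\<epsilon> > 0"
    and max: "\<And>x t. x \<in> S2 \<Longrightarrow> t1 \<le> t \<Longrightarrow> t \<le> t0 \<Longrightarrow> gap (x, t) - \<epsilon> * t \<le> gap (u, t0) - \<epsilon> * t0"
  shows False
proof -
  let ?z = "(u, t0)"
  have z: "?z \<in> W" using t u by (auto simp: W_def)
  have "gap (x, t0) \<le> gap ?z" if "x \<in> S2" for x using max[OF that, of t0] t by simp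
  note sp = gap_spatial_max[OF t(1) u this]
  obtain w where w: "B (0, 1) ?z = (w, 1)" using B_time_ex[OF z] by blast
  \<comment> \<open>The dual time field is (w, 1), and the derivative along w is zero at the spatial
    maximum; hence the derivative at fixed parameter has the same sign.\<close>
  have le: "dirder (0, 1) gap ?z \<le> 0"
    using sp(1) dirder_split[OF smooth_gap z, of w 1] sp(2)[of w] unfolding DD_def w by simp
  have "?z + 0 *\<^sub>R (0, 1) \<in> W" using z by simp
  from dirder_line[OF smooth_gap this]
  have d: "((\<lambda>h. gap (u, t0 + h)) has_real_derivative dirder (0, 1) gap ?z) (at 0)" by simp
  have "((\<lambda>h. gap (u, t0 + h) - \<epsilon> * (t0 + h)) has_real_derivative dirder (0, 1) gap ?z - \<epsilon>) (at 0)"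
    by (rule derivative_eq_intros d refl | simp)+
  from DERIV_neg_dec_left[OF this] le \<epsilon>
  obtain d where d: "d > 0" "\<And>h. 0 < h \<Longrightarrow> h < d \<Longrightarrow> gap (u, t0) - \<epsilon> * t0 < gap (u, t0 - h) - \<epsilon> * (t0 - h)"
    by auto
  define h where "h = min d (t0 - t1) / 2"
  have "0 < h" "h < d" "h < t0 - t1" using d(1) t by (auto simp: h_def)
  then show False using d(2)[of h] max[OF u, of "t0 - h"] by simp
qed

lemma gap_sup_nonincreasing:
  assumes t: "t1 \<in> {a<..<b}" "t2 \<in> {a<..<b}" "t1 \<le> t2"
  shows "(SUP u\<in>S2. gap (u, t2)) \<le> (SUP u\<in>S2. gap (u, t1))"
proof (rule ccontr)
  let ?M = "\<lambda>t. SUP u\<in>S2. gap (u, t)"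
  assume "\<not> ?M t2 \<le> ?M t1"
  then have less: "?M t1 < ?M t2" by simp
  then have "t1 < t2" using t by (cases "t1 = t2") auto
  have cont: "continuous_on (S2 \<times> {t1..t2}) gap"
    by (rule continuous_on_subset[OF smooth_on_continuous_on[OF smooth_gap]])
      (use t in \<open>auto simp: W_def\<close>)
  have comp: "compact (S2 \<times> {t1..t2})" by (intro compact_Times) auto
  obtain u0 :: "real^3" where u0: "u0 \<in> S2" using vector_choose_size[of 1] by auto
  have bdd: "bdd_above ((\<lambda>u. gap (u, t)) ` S2)" if "t \<in> {t1..t2}" for t
  proof -
    have "bounded (gap ` (S2 \<times> {t1..t2}))"
      by (intro compact_imp_bounded compact_continuous_image cont comp)
    moreover have "(\<lambda>u. gap (u, t)) ` S2 \<subseteq> gap ` (S2 \<times> {t1..t2})" using that by auto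
    ultimately show ?thesis by (rule bounded_imp_bdd_above[OF bounded_subset])
  qed
  \<comment> \<open>With this slope \<epsilon> t absorbs exactly half of the supposed increase
    between t1 and t2, so the maximum of gap - \<epsilon> t over the slab cannot lie at t1.\<close>
  define \<epsilon> where "\<epsilon> = (?M t2 - ?M t1) / (2 * (t2 - t1))"
  have \<epsilon>: "\<epsilon> > 0" "\<epsilon> * (t2 - t1) = (?M t2 - ?M t1) / 2"
    using less \<open>t1 < t2\<close> by (simp_all add: \<epsilon>_def field_simps)
  have "continuous_on (S2 \<times> {t1..t2}) (\<lambda>z. gap z - \<epsilon> * snd z)"
    by (intro continuous_intros cont)
  moreover have "S2 \<times> {t1..t2} \<noteq> {}" using u0 \<open>t1 < t2\<close> by auto
  ultimately obtain z where z: "z \<in> S2 \<times> {t1..t2}"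
    "\<And>y. y \<in> S2 \<times> {t1..t2} \<Longrightarrow> gap y - \<epsilon> * snd y \<le> gap z - \<epsilon> * snd z"
    using continuous_attains_sup[OF comp] by blast
  obtain u t0 where ut: "z = (u, t0)" "u \<in> S2" "t1 \<le> t0" "t0 \<le> t2" using z(1) by auto
  have "t0 \<noteq> t1"
  proof
    assume "t0 = t1"
    have "gap (x, t2) \<le> ?M t1 + \<epsilon> * (t2 - t1)" if "x \<in> S2" for x
    proof -
      have "gap (x, t2) - \<epsilon> * t2 \<le> gap (u, t1) - \<epsilon> * t1"
        using z(2)[of "(x, t2)"] that \<open>t1 < t2\<close> ut(1) \<open>t0 = t1\<close> by simp
      moreover have "gap (u, t1) \<le> ?M t1"
        by (rule cSUP_upper[OF ut(2) bdd]) (use \<open>t1 < t2\<close> in simp)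
      ultimately show ?thesis by (simp add: right_diff_distrib)
    qed
    then have "?M t2 \<le> ?M t1 + \<epsilon> * (t2 - t1)" using u0 by (intro cSUP_least) auto
    moreover have "y \<le> x" if "y \<le> x + e" "e = (y - x) / 2" for x y e :: real using that by (simp add: field_simps)
    ultimately have "?M t2 \<le> ?M t1" using \<epsilon>(2) by blast
    then show False using less by (meson leD)
  qed
  then have "t1 < t0" using ut by simp
  show False
  proof (rule gap_interior_max[OF _ t(1) \<open>t1 < t0\<close> ut(2) \<epsilon>(1)])
    show "t0 \<in> {a<..<b}" using t ut by auto
    show "gap (x, t) - \<epsilon> * t \<le> gap (u, t0) - \<epsilon> * t0" if "x \<in> S2" "t1 \<le> t" "t \<le> t0" for x t
      using z(2)[of "(x, t)"] that ut by simp
  qed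
qed

end

theorem theorem3p1:
  fixes X N :: "real^3 \<Rightarrow> real \<Rightarrow> real^3" and a b :: real and U :: "((real^3) \<times> real) set"
  assumes "a < b"
    and "S2 \<times> {a<..<b} \<subseteq> U"
    and "smooth_on U (\<lambda>(x, t). X x t)"
    and "smooth_on U (\<lambda>(x, t). N x t)"
    and "\<And>t. t \<in> {a<..<b} \<Longrightarrow> closed_strictly_convex_surface X N t"
    and "\<And>u t. u \<in> S2 \<Longrightarrow> t \<in> {a<..<b} \<Longrightarrow>
           ((\<lambda>s. X u s) has_vector_derivative (1 / gaussK X N u t) *\<^sub>R N u t) (at t)"
  shows "(\<forall>t\<in>{a<..<b}.
            (SUP u\<in>S2. (lam1 X N u t - lam2 X N u t)\<^sup>2 / (4 * (lam1 X N u t)\<^sup>2 * (lam2 X N u t)\<^sup>2))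
          = (SUP u\<in>S2. (2 * normA2 X N u t - (meanH X N u t)\<^sup>2) / ((meanH X N u t)\<^sup>2 - normA2 X N u t)\<^sup>2))
      \<and> (\<forall>t1\<in>{a<..<b}. \<forall>t2\<in>{a<..<b}. t1 \<le> t2 \<longrightarrow>
            (SUP u\<in>S2. (lam1 X N u t2 - lam2 X N u t2)\<^sup>2 / (4 * (lam1 X N u t2)\<^sup>2 * (lam2 X N u t2)\<^sup>2))
         \<le> (SUP u\<in>S2. (lam1 X N u t1 - lam2 X N u t1)\<^sup>2 / (4 * (lam1 X N u t1)\<^sup>2 * (lam2 X N u t1)\<^sup>2)))"
proof -
  interpret gauss_flow X N a b U
    by unfold_locales (use assms in auto)
  let ?G = "\<lambda>t u. (lam1 X N u t - lam2 X N u t)\<^sup>2 / (4 * (lam1 X N u t)\<^sup>2 * (lam2 X N u t)\<^sup>2)"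
  have gap: "?G t u = gap (u, t)" if "u \<in> S2" for u t
    using that by (simp add: gap_def dir_def s_def Let_def)
  \<comment> \<open>The two forms of the quantity agree pointwise, since 2|A|^2 - H^2 = (\<lambda>_1
    - \<lambda>_2)^2 and H^2 - |A|^2 = 2 K.\<close>
  have num: "2 * normA2 X N u t - (meanH X N u t)\<^sup>2 = (lam1 X N u t - lam2 X N u t)\<^sup>2" for u t
    by (simp add: normA2_def meanH_def power2_eq_square algebra_simps)
  have den: "(meanH X N u t)\<^sup>2 - normA2 X N u t = 2 * (lam1 X N u t * lam2 X N u t)" for u t
    by (simp add: normA2_def meanH_def power2_eq_square algebra_simps)
  have "(2 * normA2 X N u t - (meanH X N u t)\<^sup>2) / ((meanH X N u t)\<^sup>2 - normA2 X N u t)\<^sup>2 = ?G t u" for u t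
    unfolding num den by (simp add: power_mult_distrib mult.assoc)
  moreover have "(SUP u\<in>S2. ?G t2 u) \<le> (SUP u\<in>S2. ?G t1 u)" if "t1 \<in> {a<..<b}" "t2 \<in> {a<..<b}" "t1 \<le> t2" for t1 t2
  proof -
    have "(SUP u\<in>S2. ?G t u) = (SUP u\<in>S2. gap (u, t))" for t
      by (rule SUP_cong[OF refl gap])
    then show ?thesis using gap_sup_nonincreasing[OF that] by (simp only:)
  qed
  ultimately show ?thesis by simp
qed

end
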